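(* Let $\mathsf{M}$ and $\mathsf{N}$ be algebras with bracket (AWBs) with mutual compatible actions on each other, and let $\mathsf{M}\boxtimes\mathsf{N}$ be the vector space with generators $m\odot n$, $n\odot m$, $m\circledast n$, $n\circledast m$ ($m\in\mathsf{M}$, $n\in\mathsf{N}$) and relations described in the context. To each generator $g$ associate the pair $(g_{\mathsf{M}},g_{\mathsf{N}})\in\mathsf{M}\times\mathsf{N}$ by $$m\odot n\mapsto(m^{\cdot n},{}^{m\cdot}n),\quad n\odot m\mapsto({}^{n\cdot}m,n^{\cdot m}),\quad m\circledast n\mapsto(m^{\ast n},{}^{m\ast}n),\quad n\circledast m\mapsto({}^{n\ast}m,n^{\ast m}).$$ Then the vector space $\mathsf{M}\boxtimes\mathsf{N}$, endowed with the product and bracket operations given on generators $g,h$ by $$g\,h=g_{\mathsf{M}}\odot h_{\mathsf{N}},\qquad [g,h]=g_{\mathsf{M}}\circledast h_{\mathsf{N}}$$ (for example $(m\odot n)(m'\odot n')=(m^{\cdot n})\odot({}^{m'\cdot}n')$ and $[n\circledast m,m'\odot n']=({}^{n\ast}m)\circledast({}^{m'\cdot}n')$), has the structure of an AWB.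
   Context: All vector spaces and algebras are over a fixed field $\mathbb{K}$. An algebra with bracket (AWB) is an associative, not necessarily commutative (and not necessarily unital) algebra $\mathsf{A}$ with a bilinear map $[-,-]:\mathsf{A}\times\mathsf{A}\to\mathsf{A}$ such that $[ab,c]=[a,c]b+a[b,c]$ for all $a,b,c$. Action: an action of an AWB $\mathsf{A}$ on an AWB $\mathsf{M}$ consists of four bilinear maps $(a,m)\mapsto{}^{a\cdot}m$, $(m,a)\mapsto m^{\cdot a}$, $(a,m)\mapsto{}^{a\ast}m$, $(m,a)\mapsto m^{\ast a}$ with values in $\mathsf{M}$ such that for all $a,a_1,a_2\in\mathsf{A}$, $m,m_1,m_2\in\mathsf{M}$: ${}^{(a_1a_2)\cdot}m={}^{a_1\cdot}({}^{a_2\cdot}m)$; $\ m^{\cdot(a_1a_2)}=(m^{\cdot a_1})^{\cdot a_2}$; $\ ({}^{a_1\cdot}m)^{\cdot a_2}={}^{a_1\cdot}(m^{\cdot a_2})$; $({}^{a_1\cdot}m)^{\ast a_2}={}^{a_1\cdot}(m^{\ast a_2})+{}^{[a_1,a_2]\cdot}m$; $\ (m^{\cdot a_1})^{\ast a_2}=(m^{\ast a_2})^{\cdot a_1}+m^{\cdot[a_1,a_2]}$; $\ {}^{(a_1a_2)\ast}m={}^{a_1\cdot}({}^{a_2\ast}m)+({}^{a_1\ast}m)^{\cdot a_2}$; $(m_1m_2)^{\cdot a}=m_1(m_2^{\cdot a})$; $\ {}^{a\cdot}(m_1m_2)=({}^{a\cdot}m_1)m_2$; $\ (m_1^{\cdot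 a})m_2=m_1({}^{a\cdot}m_2)$; $[m_1^{\cdot a},m_2]=m_1({}^{a\ast}m_2)+[m_1,m_2]^{\cdot a}$; $\ [{}^{a\cdot}m_1,m_2]={}^{a\cdot}[m_1,m_2]+({}^{a\ast}m_2)m_1$; $\ (m_1m_2)^{\ast a}=m_1(m_2^{\ast a})+(m_1^{\ast a})m_2$. Let $\mathsf{M},\mathsf{N}$ be AWBs with mutual actions on each other. Call a pair $(u_{\mathsf{M}},u_{\mathsf{N}})\in\mathsf{M}\times\mathsf{N}$ basic if it is one of $(m^{\cdot n},{}^{m\cdot}n)$, $({}^{n\cdot}m,n^{\cdot m})$, $(m^{\ast n},{}^{m\ast}n)$, $({}^{n\ast}m,n^{\ast m})$ for some $m\in\mathsf{M}$, $n\in\mathsf{N}$. Compatible actions: the actions are compatible if for every basic pair $(u_{\mathsf{M}},u_{\mathsf{N}})$ and all $m\in\mathsf{M}$, $n\in\mathsf{N}$: $m^{\cdot u_{\mathsf{N}}}=m\,u_{\mathsf{M}}$, $\ m^{\ast u_{\mathsf{N}}}=[m,u_{\mathsf{M}}]$, $\ {}^{u_{\mathsf{M}}\cdot}n=u_{\mathsf{N}}\,n$, $\ {}^{u_{\mathsf{M}}\ast}n=[u_{\mathsf{N}},n]$, and symmetrically $n^{\cdot u_{\mathsf{M}}}=n\,u_{\mathsf{N}}$, $\ n^{\ast u_{\mathsf{M}}}=[n,u_{\mathsf{N}}]$, $\ {}^{u_{\mathsf{N}}\cdot}m=u_{\mathsf{M}}\,m$, $\ {}^{u_{\mathsf{N}}\ast}m=[u_{\mathsf{M}},m]$.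 The vector space $\mathsf{M}\boxtimes\mathsf{N}$ (for compatible actions): it is the vector space spanned by formal symbols $m\odot n$, $n\odot m$, $m\circledast n$, $n\circledast m$ for $m\in\mathsf{M}$, $n\in\mathsf{N}$ (four formally distinct families, also when $\mathsf{M}$ and $\mathsf{N}$ have elements in common), modulo the following relations, for all $\lambda\in\mathbb{K}$ and all elements, where $\star$ stands for either of $\odot$, $\circledast$: (1) $\lambda(m\star n)=(\lambda m)\star n=m\star(\lambda n)$, $(m+m')\star n=m\star n+m'\star n$, $m\star(n+n')=m\star n+m\star n'$; (2) $u_{\mathsf{M}}\star v_{\mathsf{N}}=u_{\mathsf{N}}\star v_{\mathsf{M}}$ for all basic pairs $(u_{\mathsf{M}},u_{\mathsf{N}})$, $(v_{\mathsf{M}},v_{\mathsf{N}})$; (3) $(m_1m_2)\odot n=m_1\odot({}^{m_2\cdot}n)$; $\ n\odot(m_1m_2)=(n^{\cdot m_1})\odot m_2$; $\ (m_1m_2)\circledast n=m_1\odot({}^{m_2\ast}n)+({}^{m_1\ast}n)\odot m_2$; $\ ({}^{m_1\cdot}n)\circledast m_2=m_1\odot(n^{\ast m_2})+[m_1,m_2]\odot n$; $\ (n^{\cdot m_1})\circledast m_2=(n^{\ast m_2})\odot m_1+n\odot[m_1,m_2]$; $\ ({}^{m_1\cdot}n)\odot m_2=m_1\odot(n^{\cdot m_2})$; (4) all relations obtained from (1) and (3) by exchanging the roles of elements of $\mathsf{M}$ and $\mathsf{N}$. *)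

theory Defs
  imports "HOL-Algebra.Module" "HOL-Algebra.AbelCoset" "HOL.Hull"
begin

section \<open>Algebras with bracket\<close>

definition bilinear_map ::
  "('k, 'r) ring_scheme \<Rightarrow> ('k, 'a, 'x) module_scheme \<Rightarrow> ('k, 'b, 'y) module_scheme \<Rightarrow>
   ('k, 'c, 'z) module_scheme \<Rightarrow> ('a \<Rightarrow> 'b \<Rightarrow> 'c) \<Rightarrow> bool" where
  "bilinear_map K A B C f \<longleftrightarrow>
     (\<forall>a\<in>carrier A. \<forall>b\<in>carrier B. f a b \<in> carrier C) \<and>
     (\<forall>a\<in>carrier A. \<forall>a'\<in>carrier A. \<forall>b\<in>carrier B.
        f (a \<oplus>\<^bsub>A\<^esub> a') b = f a b \<oplus>\<^bsub>C\<^esub> f a' b) \<and>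
     (\<forall>a\<in>carrier A. \<forall>b\<in>carrier B. \<forall>b'\<in>carrier B.
        f a (b \<oplus>\<^bsub>B\<^esub> b') = f a b \<oplus>\<^bsub>C\<^esub> f a b') \<and>
     (\<forall>k\<in>carrier K. \<forall>a\<in>carrier A. \<forall>b\<in>carrier B.
        f (k \<odot>\<^bsub>A\<^esub> a) b = k \<odot>\<^bsub>C\<^esub> f a b \<and> f a (k \<odot>\<^bsub>B\<^esub> b) = k \<odot>\<^bsub>C\<^esub> f a b)"

text \<open>The field \<open>one\<close> inherited from the record of rings plays no role: algebras need not be unital.\<close>

record ('k, 'a) awb = "('k, 'a) module" +
  bracket :: "'a \<Rightarrow> 'a \<Rightarrow> 'a"

locale awb = K?: field K + A?: module K A
  for K :: "('k, 'r) ring_scheme" (structure) and A :: "('k, 'a, 'x) awb_scheme" (structure) +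
  assumes mult_bilinear: "bilinear_map K A A A (mult A)"
    and mult_assoc: "\<And>a b c. \<lbrakk>a \<in> carrier A; b \<in> carrier A; c \<in> carrier A\<rbrakk> \<Longrightarrow>
      (a \<otimes>\<^bsub>A\<^esub> b) \<otimes>\<^bsub>A\<^esub> c = a \<otimes>\<^bsub>A\<^esub> (b \<otimes>\<^bsub>A\<^esub> c)"
    and bracket_bilinear: "bilinear_map K A A A (bracket A)"
    and bracket_mult: "\<And>a b c. \<lbrakk>a \<in> carrier A; b \<in> carrier A; c \<in> carrier A\<rbrakk> \<Longrightarrow>
      bracket A (a \<otimes>\<^bsub>A\<^esub> b) c = bracket A a c \<otimes>\<^bsub>A\<^esub> b \<oplus>\<^bsub>A\<^esub> a \<otimes>\<^bsub>A\<^esub> bracket A b c"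


section \<open>Actions\<close>

text \<open>
  \<open>ldot a m\<close> and \<open>rdot m a\<close> are the left and right dot actions, \<open>lstar a m\<close> and \<open>rstar m a\<close> the
  left and right star actions of \<open>a\<close> on \<open>m\<close>.
\<close>

record ('a, 'm) action =
  ldot :: "'a \<Rightarrow> 'm \<Rightarrow> 'm"
  rdot :: "'m \<Rightarrow> 'a \<Rightarrow> 'm"
  lstar :: "'a \<Rightarrow> 'm \<Rightarrow> 'm"
  rstar :: "'m \<Rightarrow> 'a \<Rightarrow> 'm"

locale awb_action = A?: awb K A + M?: awb K M
  for K :: "('k, 'r) ring_scheme" (structure) and A :: "('k, 'a, 'x) awb_scheme" (structure)
    and M :: "('k, 'm, 'y) awb_scheme" (structure) and act :: "('a, 'm) action" +
  assumes ldot_bilinear: "bilinear_map K A M M (ldot act)"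
    and rdot_bilinear: "bilinear_map K M A M (rdot act)"
    and lstar_bilinear: "bilinear_map K A M M (lstar act)"
    and rstar_bilinear: "bilinear_map K M A M (rstar act)"
    and act_axioms1: "\<And>a1 a2 m. \<lbrakk>a1 \<in> carrier A; a2 \<in> carrier A; m \<in> carrier M\<rbrakk> \<Longrightarrow>
        ldot act (a1 \<otimes>\<^bsub>A\<^esub> a2) m = ldot act a1 (ldot act a2 m) \<and>
        rdot act m (a1 \<otimes>\<^bsub>A\<^esub> a2) = rdot act (rdot act m a1) a2 \<and>
        rdot act (ldot act a1 m) a2 = ldot act a1 (rdot act m a2) \<and>
        rstar act (ldot act a1 m) a2 =
          ldot act a1 (rstar act m a2) \<oplus>\<^bsub>M\<^esub> ldot act (bracket A a1 a2) m \<and>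
        rstar act (rdot act m a1) a2 =
          rdot act (rstar act m a2) a1 \<oplus>\<^bsub>M\<^esub> rdot act m (bracket A a1 a2) \<and>
        lstar act (a1 \<otimes>\<^bsub>A\<^esub> a2) m =
          ldot act a1 (lstar act a2 m) \<oplus>\<^bsub>M\<^esub> rdot act (lstar act a1 m) a2"
    and act_axioms2: "\<And>a m1 m2. \<lbrakk>a \<in> carrier A; m1 \<in> carrier M; m2 \<in> carrier M\<rbrakk> \<Longrightarrow>
        rdot act (m1 \<otimes>\<^bsub>M\<^esub> m2) a = m1 \<otimes>\<^bsub>M\<^esub> rdot act m2 a \<and>
        ldot act a (m1 \<otimes>\<^bsub>M\<^esub> m2) = ldot act a m1 \<otimes>\<^bsub>M\<^esub> m2 \<and>
        rdot act m1 a \<otimes>\<^bsub>M\<^esub> m2 = m1 \<otimes>\<^bsub>M\<^esub> ldot act a m2 \<and>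
        bracket M (rdot act m1 a) m2 =
          m1 \<otimes>\<^bsub>M\<^esub> lstar act a m2 \<oplus>\<^bsub>M\<^esub> rdot act (bracket M m1 m2) a \<and>
        bracket M (ldot act a m1) m2 =
          ldot act a (bracket M m1 m2) \<oplus>\<^bsub>M\<^esub> lstar act a m2 \<otimes>\<^bsub>M\<^esub> m1 \<and>
        rstar act (m1 \<otimes>\<^bsub>M\<^esub> m2) a =
          m1 \<otimes>\<^bsub>M\<^esub> rstar act m2 a \<oplus>\<^bsub>M\<^esub> rstar act m1 a \<otimes>\<^bsub>M\<^esub> m2"


section \<open>Generators, basic pairs and compatible actions\<close>

text \<open>The symbols \<open>m \<odot> n\<close>, \<open>n \<odot> m\<close>, \<open>m \<circledast> n\<close>, \<open>n \<circledast> m\<close>, in this order.\<close>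

datatype ('m, 'n) gen = DotMN 'm 'n | DotNM 'n 'm | StarMN 'm 'n | StarNM 'n 'm

definition gens :: "('m, 'x) partial_object_scheme \<Rightarrow> ('n, 'y) partial_object_scheme \<Rightarrow>
    ('m, 'n) gen set" where
  "gens M N = (\<Union>m\<in>carrier M. \<Union>n\<in>carrier N. {DotMN m n, DotNM n m, StarMN m n, StarNM n m})"

text \<open>
  The pair \<open>(g\<^sub>M, g\<^sub>N)\<close> of a generator \<open>g\<close>. Here and below \<open>aMN\<close> is the action of \<open>M\<close> on \<open>N\<close>
  and \<open>aNM\<close> the action of \<open>N\<close> on \<open>M\<close>.
\<close>

fun gen_M :: "('n, 'm) action \<Rightarrow> ('m, 'n) gen \<Rightarrow> 'm" where
  "gen_M aNM (DotMN m n) = rdot aNM m n"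
| "gen_M aNM (DotNM n m) = ldot aNM n m"
| "gen_M aNM (StarMN m n) = rstar aNM m n"
| "gen_M aNM (StarNM n m) = lstar aNM n m"

fun gen_N :: "('m, 'n) action \<Rightarrow> ('m, 'n) gen \<Rightarrow> 'n" where
  "gen_N aMN (DotMN m n) = ldot aMN m n"
| "gen_N aMN (DotNM n m) = rdot aMN n m"
| "gen_N aMN (StarMN m n) = lstar aMN m n"
| "gen_N aMN (StarNM n m) = rstar aMN n m"

definition basic_pairs :: "('m, 'x) partial_object_scheme \<Rightarrow> ('n, 'y) partial_object_scheme \<Rightarrow>
    ('m, 'n) action \<Rightarrow> ('n, 'm) action \<Rightarrow> ('m \<times> 'n) set" where
  "basic_pairs M N aMN aNM = (\<lambda>g. (gen_M aNM g, gen_N aMN g)) ` gens M N"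

definition compatible :: "('k, 'm, 'x) awb_scheme \<Rightarrow> ('k, 'n, 'y) awb_scheme \<Rightarrow>
    ('m, 'n) action \<Rightarrow> ('n, 'm) action \<Rightarrow> bool" where
  "compatible M N aMN aNM \<longleftrightarrow>
     (\<forall>(u\<^sub>M, u\<^sub>N) \<in> basic_pairs M N aMN aNM. \<forall>m\<in>carrier M. \<forall>n\<in>carrier N.
        rdot aNM m u\<^sub>N = m \<otimes>\<^bsub>M\<^esub> u\<^sub>M \<and> rstar aNM m u\<^sub>N = bracket M m u\<^sub>M \<and>
        ldot aMN u\<^sub>M n = u\<^sub>N \<otimes>\<^bsub>N\<^esub> n \<and> lstar aMN u\<^sub>M n = bracket N u\<^sub>N n \<and>
        rdot aMN n u\<^sub>M = n \<otimes>\<^bsub>N\<^esub> u\<^sub>N \<and> rstar aMN n u\<^sub>M = bracket N n u\<^sub>N \<and>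
        ldot aNM u\<^sub>N m = u\<^sub>M \<otimes>\<^bsub>M\<^esub> m \<and> lstar aNM u\<^sub>N m = bracket M u\<^sub>M m)"


section \<open>Free vector spaces and quotients\<close>

text \<open>
  The fields \<open>mult\<close> and \<open>one\<close> of the module records below are irrelevant.
\<close>

definition free_vs :: "('k, 'r) ring_scheme \<Rightarrow> 'g set \<Rightarrow> ('k, 'g \<Rightarrow> 'k) module" where
  "free_vs K G =
     \<lparr>carrier = {f. range f \<subseteq> carrier K \<and> finite {g. f g \<noteq> \<zero>\<^bsub>K\<^esub>} \<and> {g. f g \<noteq> \<zero>\<^bsub>K\<^esub>} \<subseteq> G},
      mult = undefined, one = undefined,
      zero = (\<lambda>g. \<zero>\<^bsub>K\<^esub>), add = (\<lambda>f h g. f g \<oplus>\<^bsub>K\<^esub> h g),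
      smult = (\<lambda>k f g. k \<otimes>\<^bsub>K\<^esub> f g)\<rparr>"

definition sym_vec :: "('k, 'r) ring_scheme \<Rightarrow> 'g \<Rightarrow> 'g \<Rightarrow> 'k" where
  "sym_vec K g = (\<lambda>h. if h = g then \<one>\<^bsub>K\<^esub> else \<zero>\<^bsub>K\<^esub>)"

definition quotient_vs :: "('k, 'v, 'x) module_scheme \<Rightarrow> 'v set \<Rightarrow> ('k, 'v set) module" where
  "quotient_vs V W =
     \<lparr>carrier = a_rcosets\<^bsub>V\<^esub> W, mult = undefined, one = undefined,
      zero = W, add = set_add V,
      smult = (\<lambda>k X. \<Union>x\<in>X. W +>\<^bsub>V\<^esub> (k \<odot>\<^bsub>V\<^esub> x))\<rparr>"


section \<open>The vector space \<open>M \<boxtimes> N\<close>\<close>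

text \<open>
  Relations are pairs (left-hand side, right-hand side). The following set contains those of
  bilinearity and those linking product, bracket and action, for \<open>a \<odot> b = d a b\<close>,
  \<open>b \<odot> a = d' b a\<close>, \<open>a \<circledast> b = s a b\<close>, \<open>b \<circledast> a = s' b a\<close>, where \<open>act\<close> is the action of \<open>A\<close> on \<open>B\<close>.
  Of bilinearity it contains only the part about \<open>a \<star> b\<close>; the part about \<open>b \<star> a\<close> is obtained when
  the roles of \<open>A\<close> and \<open>B\<close> are exchanged.
\<close>

inductive_set half_relations ::
  "('k, 'r) ring_scheme \<Rightarrow> ('k, 'a, 'x) awb_scheme \<Rightarrow> ('k, 'b, 'y) awb_scheme \<Rightarrow>
   ('a, 'b) action \<Rightarrow> ('k, 'v, 'z) module_scheme \<Rightarrow> ('a \<Rightarrow> 'b \<Rightarrow> 'v) \<Rightarrow> ('b \<Rightarrow> 'a \<Rightarrow> 'v) \<Rightarrow>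
   ('a \<Rightarrow> 'b \<Rightarrow> 'v) \<Rightarrow> ('b \<Rightarrow> 'a \<Rightarrow> 'v) \<Rightarrow> ('v \<times> 'v) set"
  for K A B act V d d' s s' where
  smult_left: "\<lbrakk>t \<in> {d, s}; k \<in> carrier K; a \<in> carrier A; b \<in> carrier B\<rbrakk> \<Longrightarrow>
    (k \<odot>\<^bsub>V\<^esub> t a b, t (k \<odot>\<^bsub>A\<^esub> a) b) \<in> half_relations K A B act V d d' s s'"
| smult_right: "\<lbrakk>t \<in> {d, s}; k \<in> carrier K; a \<in> carrier A; b \<in> carrier B\<rbrakk> \<Longrightarrow>
    (k \<odot>\<^bsub>V\<^esub> t a b, t a (k \<odot>\<^bsub>B\<^esub> b)) \<in> half_relations K A B act V d d' s s'"
| add_left: "\<lbrakk>t \<in> {d, s}; a \<in> carrier A; a' \<in> carrier A; b \<in> carrier B\<rbrakk> \<Longrightarrow>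
    (t (a \<oplus>\<^bsub>A\<^esub> a') b, t a b \<oplus>\<^bsub>V\<^esub> t a' b) \<in> half_relations K A B act V d d' s s'"
| add_right: "\<lbrakk>t \<in> {d, s}; a \<in> carrier A; b \<in> carrier B; b' \<in> carrier B\<rbrakk> \<Longrightarrow>
    (t a (b \<oplus>\<^bsub>B\<^esub> b'), t a b \<oplus>\<^bsub>V\<^esub> t a b') \<in> half_relations K A B act V d d' s s'"
| mult_dot: "\<lbrakk>a1 \<in> carrier A; a2 \<in> carrier A; b \<in> carrier B\<rbrakk> \<Longrightarrow>
    (d (a1 \<otimes>\<^bsub>A\<^esub> a2) b, d a1 (ldot act a2 b)) \<in> half_relations K A B act V d d' s s'"
| dot_mult: "\<lbrakk>a1 \<in> carrier A; a2 \<in> carrier A; b \<in> carrier B\<rbrakk> \<Longrightarrow>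
    (d' b (a1 \<otimes>\<^bsub>A\<^esub> a2), d' (rdot act b a1) a2) \<in> half_relations K A B act V d d' s s'"
| mult_star: "\<lbrakk>a1 \<in> carrier A; a2 \<in> carrier A; b \<in> carrier B\<rbrakk> \<Longrightarrow>
    (s (a1 \<otimes>\<^bsub>A\<^esub> a2) b, d a1 (lstar act a2 b) \<oplus>\<^bsub>V\<^esub> d' (lstar act a1 b) a2)
      \<in> half_relations K A B act V d d' s s'"
| ldot_star: "\<lbrakk>a1 \<in> carrier A; a2 \<in> carrier A; b \<in> carrier B\<rbrakk> \<Longrightarrow>
    (s' (ldot act a1 b) a2, d a1 (rstar act b a2) \<oplus>\<^bsub>V\<^esub> d (bracket A a1 a2) b)
      \<in> half_relations K A B act V d d' s s'"
| rdot_star: "\<lbrakk>a1 \<in> carrier A; a2 \<in> carrier A; b \<in> carrier B\<rbrakk> \<Longrightarrow>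
    (s' (rdot act b a1) a2, d' (rstar act b a2) a1 \<oplus>\<^bsub>V\<^esub> d' b (bracket A a1 a2))
      \<in> half_relations K A B act V d d' s s'"
| ldot_dot: "\<lbrakk>a1 \<in> carrier A; a2 \<in> carrier A; b \<in> carrier B\<rbrakk> \<Longrightarrow>
    (d' (ldot act a1 b) a2, d a1 (rdot act b a2)) \<in> half_relations K A B act V d d' s s'"

definition box_relations ::
  "('k, 'r) ring_scheme \<Rightarrow> ('k, 'm, 'x) awb_scheme \<Rightarrow> ('k, 'n, 'y) awb_scheme \<Rightarrow>
   ('m, 'n) action \<Rightarrow> ('n, 'm) action \<Rightarrow>
   ((('m, 'n) gen \<Rightarrow> 'k) \<times> (('m, 'n) gen \<Rightarrow> 'k)) set" where
  "box_relations K M N aMN aNM =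
     (let F = free_vs K (gens M N);
          dMN = (\<lambda>m n. sym_vec K (DotMN m n)); dNM = (\<lambda>n m. sym_vec K (DotNM n m));
          sMN = (\<lambda>m n. sym_vec K (StarMN m n)); sNM = (\<lambda>n m. sym_vec K (StarNM n m))
      in half_relations K M N aMN F dMN dNM sMN sNM \<union>
         half_relations K N M aNM F dNM dMN sNM sMN \<union>
         (\<Union>(u\<^sub>M, u\<^sub>N) \<in> basic_pairs M N aMN aNM. \<Union>(v\<^sub>M, v\<^sub>N) \<in> basic_pairs M N aMN aNM.
            {(dMN u\<^sub>M v\<^sub>N, dNM u\<^sub>N v\<^sub>M), (sMN u\<^sub>M v\<^sub>N, sNM u\<^sub>N v\<^sub>M)}))"

definition box_subspace ::
  "('k, 'r) ring_scheme \<Rightarrow> ('k, 'm, 'x) awb_scheme \<Rightarrow> ('k, 'n, 'y) awb_scheme \<Rightarrow>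
   ('m, 'n) action \<Rightarrow> ('n, 'm) action \<Rightarrow> (('m, 'n) gen \<Rightarrow> 'k) set" where
  "box_subspace K M N aMN aNM =
     (let F = free_vs K (gens M N)
      in (\<lambda>W. submodule W K F) hull ((\<lambda>(x, y). x \<ominus>\<^bsub>F\<^esub> y) ` box_relations K M N aMN aNM))"

definition box_vs ::
  "('k, 'r) ring_scheme \<Rightarrow> ('k, 'm, 'x) awb_scheme \<Rightarrow> ('k, 'n, 'y) awb_scheme \<Rightarrow>
   ('m, 'n) action \<Rightarrow> ('n, 'm) action \<Rightarrow> ('k, (('m, 'n) gen \<Rightarrow> 'k) set) module" where
  "box_vs K M N aMN aNM =
     quotient_vs (free_vs K (gens M N)) (box_subspace K M N aMN aNM)"

text \<open>The class of a generator in \<open>M \<boxtimes> N\<close>.\<close>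

definition box_gen ::
  "('k, 'r) ring_scheme \<Rightarrow> ('k, 'm, 'x) awb_scheme \<Rightarrow> ('k, 'n, 'y) awb_scheme \<Rightarrow>
   ('m, 'n) action \<Rightarrow> ('n, 'm) action \<Rightarrow> ('m, 'n) gen \<Rightarrow> (('m, 'n) gen \<Rightarrow> 'k) set" where
  "box_gen K M N aMN aNM g =
     box_subspace K M N aMN aNM +>\<^bsub>free_vs K (gens M N)\<^esub> sym_vec K g"

text \<open>
  \<open>p\<close> and \<open>b\<close> are bilinear operations on \<open>M \<boxtimes> N\<close> with the prescribed values on generators.
\<close>

definition box_operations ::
  "('k, 'r) ring_scheme \<Rightarrow> ('k, 'm, 'x) awb_scheme \<Rightarrow> ('k, 'n, 'y) awb_scheme \<Rightarrow>
   ('m, 'n) action \<Rightarrow> ('n, 'm) action \<Rightarrow>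
   ((('m, 'n) gen \<Rightarrow> 'k) set \<Rightarrow> (('m, 'n) gen \<Rightarrow> 'k) set \<Rightarrow> (('m, 'n) gen \<Rightarrow> 'k) set) \<Rightarrow>
   ((('m, 'n) gen \<Rightarrow> 'k) set \<Rightarrow> (('m, 'n) gen \<Rightarrow> 'k) set \<Rightarrow> (('m, 'n) gen \<Rightarrow> 'k) set) \<Rightarrow> bool"
  where
  "box_operations K M N aMN aNM p b \<longleftrightarrow>
     (let V = box_vs K M N aMN aNM; \<gamma> = box_gen K M N aMN aNM
      in bilinear_map K V V V p \<and> bilinear_map K V V V b \<and>
         (\<forall>g\<in>gens M N. \<forall>h\<in>gens M N.
            p (\<gamma> g) (\<gamma> h) = \<gamma> (DotMN (gen_M aNM g) (gen_N aMN h)) \<and>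
            b (\<gamma> g) (\<gamma> h) = \<gamma> (StarMN (gen_M aNM g) (gen_N aMN h))))"

definition with_operations :: "('k, 'v) module \<Rightarrow> ('v \<Rightarrow> 'v \<Rightarrow> 'v) \<Rightarrow> ('v \<Rightarrow> 'v \<Rightarrow> 'v) \<Rightarrow>
    ('k, 'v) awb" where
  "with_operations V p b =
     \<lparr>carrier = carrier V, mult = p, one = undefined, zero = zero V, add = add V,
      smult = smult V, bracket = b\<rparr>"

end

theory Submission
  imports Defs
begin

text \<open>
  Sending each generator \<open>g\<close> to \<open>g\<^sub>M\<close> and to \<open>g\<^sub>N\<close> defines linear maps \<open>\<phi>\<^sub>M\<close> and \<open>\<phi>\<^sub>N\<close> from
  \<open>M \<boxtimes> N\<close> to \<open>M\<close> and to \<open>N\<close>, because every defining relation is respected. For bilinearity this is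
  the bilinearity of the actions. For the others consider the component in \<open>M\<close>. A relation that
  comes from the product and bracket of \<open>M\<close> becomes, after compatibility has turned actions by \<open>u\<^sub>N\<close> into multiplication or bracket with
  \<open>u\<^sub>M\<close>, one of the axioms relating the action of \<open>N\<close> to the product and bracket of \<open>M\<close>; a relation
  that comes from those of \<open>N\<close> becomes one of the module-like axioms of that action; and
  \<open>u\<^sub>M \<star> v\<^sub>N = u\<^sub>N \<star> v\<^sub>M\<close> becomes, again by compatibility, \<open>u\<^sub>M v\<^sub>M = u\<^sub>M v\<^sub>M\<close> or
  \<open>[u\<^sub>M, v\<^sub>M] = [u\<^sub>M, v\<^sub>M]\<close>. The component in \<open>N\<close> is
  symmetric (lemmas \<open>half_relations_first\<close> and \<open>half_relations_second\<close>, combined in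
  \<open>box_projection_M\<close> and \<open>box_projection_N\<close>).

  Since \<open>\<odot>\<close> and \<open>\<circledast>\<close> are bilinear, the required operations exist and must be
  \<open>x y = \<phi>\<^sub>M(x) \<odot> \<phi>\<^sub>N(y)\<close> and \<open>[x, y] = \<phi>\<^sub>M(x) \<circledast> \<phi>\<^sub>N(y)\<close>. The axioms then need no
  computation with generators. By linearity, compatibility gives
  \<open>\<phi>\<^sub>M(x y) = \<phi>\<^sub>M(x)\<^sup>\<cdot>\<phi>\<^sub>N(y) = \<phi>\<^sub>M(x) \<phi>\<^sub>M(y)\<close>, while \<open>\<phi>\<^sub>N(y z)\<close> and \<open>\<phi>\<^sub>N([y, z])\<close> are the dot and star
  actions of \<open>\<phi>\<^sub>M(y)\<close> on \<open>\<phi>\<^sub>N(z)\<close>. The relation for \<open>(m\<^sub>1 m\<^sub>2) \<odot> n\<close> is therefore associativity.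
  The relation for \<open>(m\<^sub>1 m\<^sub>2) \<circledast> n\<close> gives
  \<open>[x y, z] = \<phi>\<^sub>M(x) \<odot> \<phi>\<^sub>N([y, z]) + \<phi>\<^sub>N([x, z]) \<odot> \<phi>\<^sub>M(y)\<close>; its first summand is \<open>x [y, z]\<close>, and
  the second is \<open>[x, z] y\<close> because \<open>\<phi>\<^sub>N(v) \<odot> \<phi>\<^sub>M(w) = \<phi>\<^sub>M(v) \<odot> \<phi>\<^sub>N(w)\<close>, the linear extension of
  the relation between basic pairs (lemma \<open>dot_swap\<close>).
\<close>

section \<open>Linear and bilinear maps\<close>

definition linear_map ::
  "('k, 'r) ring_scheme \<Rightarrow> ('k, 'a, 'x) module_scheme \<Rightarrow> ('k, 'b, 'y) module_scheme \<Rightarrow>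
   ('a \<Rightarrow> 'b) \<Rightarrow> bool" where
  "linear_map K A B f \<longleftrightarrow>
     (\<forall>a\<in>carrier A. f a \<in> carrier B) \<and>
     (\<forall>a\<in>carrier A. \<forall>a'\<in>carrier A. f (a \<oplus>\<^bsub>A\<^esub> a') = f a \<oplus>\<^bsub>B\<^esub> f a') \<and>
     (\<forall>k\<in>carrier K. \<forall>a\<in>carrier A. f (k \<odot>\<^bsub>A\<^esub> a) = k \<odot>\<^bsub>B\<^esub> f a)"

lemma linear_mapI:
  assumes "\<And>a. a \<in> carrier A \<Longrightarrow> f a \<in> carrier B"
    and "\<And>a a'. \<lbrakk>a \<in> carrier A; a' \<in> carrier A\<rbrakk> \<Longrightarrow> f (a \<oplus>\<^bsub>A\<^esub> a') = f a \<oplus>\<^bsub>B\<^esub> f a'"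
    and "\<And>k a. \<lbrakk>k \<in> carrier K; a \<in> carrier A\<rbrakk> \<Longrightarrow> f (k \<odot>\<^bsub>A\<^esub> a) = k \<odot>\<^bsub>B\<^esub> f a"
  shows "linear_map K A B f"
  using assms by (simp add: linear_map_def)

lemma linear_mapD:
  assumes "linear_map K A B f" "a \<in> carrier A"
  shows "f a \<in> carrier B"
    and "a' \<in> carrier A \<Longrightarrow> f (a \<oplus>\<^bsub>A\<^esub> a') = f a \<oplus>\<^bsub>B\<^esub> f a'"
    and "k \<in> carrier K \<Longrightarrow> f (k \<odot>\<^bsub>A\<^esub> a) = k \<odot>\<^bsub>B\<^esub> f a"
  using assms by (simp_all add: linear_map_def)

lemma linear_map_compose:
  assumes "linear_map K A B f" "linear_map K B C g"
  shows "linear_map K A C (\<lambda>x. g (f x))"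
  using assms by (simp add: linear_map_def)

lemma linear_map_diff:
  assumes "module K A" "module K B" "linear_map K A B f" "x \<in> carrier A" "y \<in> carrier A"
  shows "f (x \<ominus>\<^bsub>A\<^esub> y) = f x \<ominus>\<^bsub>B\<^esub> f y"
proof -
  interpret A: module K A by fact
  interpret B: module K B by fact
  note f = linear_mapD[OF assms(3)]
  have "f (\<ominus>\<^bsub>A\<^esub> y) = f (\<ominus>\<^bsub>K\<^esub> \<one>\<^bsub>K\<^esub> \<odot>\<^bsub>A\<^esub> y)"
    using assms(5) by (simp add: A.smult_l_minus)
  also have "\<dots> = \<ominus>\<^bsub>B\<^esub> f y"
    using assms(5) by (simp add: f B.smult_l_minus)
  finally show ?thesis
    using assms(4,5) by (simp add: A.minus_eq B.minus_eq f)
qed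

lemma submodule_by_closure:
  assumes "module K A" "H \<subseteq> carrier A" "\<zero>\<^bsub>A\<^esub> \<in> H"
    and "\<And>x y. \<lbrakk>x \<in> H; y \<in> H\<rbrakk> \<Longrightarrow> x \<oplus>\<^bsub>A\<^esub> y \<in> H"
    and smult: "\<And>k x. \<lbrakk>k \<in> carrier K; x \<in> H\<rbrakk> \<Longrightarrow> k \<odot>\<^bsub>A\<^esub> x \<in> H"
  shows "submodule H K A"
proof -
  interpret A: module K A by fact
  have "\<ominus>\<^bsub>A\<^esub> x \<in> H" if "x \<in> H" for x
  proof -
    have "\<ominus>\<^bsub>A\<^esub> x = \<ominus>\<^bsub>K\<^esub> \<one>\<^bsub>K\<^esub> \<odot>\<^bsub>A\<^esub> x"
      using that assms(2) by (auto simp: A.smult_l_minus)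
    then show ?thesis using smult[OF _ that] by simp
  qed
  then show ?thesis using assms by (intro A.submoduleI) auto
qed

lemma linear_map_zero:
  assumes "module K A" "module K B" "linear_map K A B f"
  shows "f \<zero>\<^bsub>A\<^esub> = \<zero>\<^bsub>B\<^esub>"
proof -
  interpret A: module K A by fact
  interpret B: module K B by fact
  have "f (\<zero>\<^bsub>K\<^esub> \<odot>\<^bsub>A\<^esub> \<zero>\<^bsub>A\<^esub>) = \<zero>\<^bsub>K\<^esub> \<odot>\<^bsub>B\<^esub> f \<zero>\<^bsub>A\<^esub>"
    by (rule linear_mapD(3)[OF assms(3)]) auto
  then show ?thesis using linear_mapD(1)[OF assms(3)] by simp
qed

text \<open>
  Two linear maps that agree on a generating set agree everywhere: the set where they agree is a
  submodule.
\<close>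

lemma equalizer_submodule:
  assumes "module K A" "module K B" "linear_map K A B f" "linear_map K A B g"
  shows "submodule {x \<in> carrier A. f x = g x} K A"
proof -
  interpret A: module K A by fact
  show ?thesis
    using linear_mapD[OF assms(3)] linear_mapD[OF assms(4)]
    by (intro submodule_by_closure)
      (auto simp: assms(1) linear_map_zero[OF assms(1,2,3)] linear_map_zero[OF assms(1,2,4)])
qed

lemma kernel_submodule:
  assumes "module K A" "module K B" "linear_map K A B f"
  shows "submodule {x \<in> carrier A. f x = \<zero>\<^bsub>B\<^esub>} K A"
proof -
  interpret B: module K B by fact
  have "linear_map K A B (\<lambda>x. \<zero>\<^bsub>B\<^esub>)"
    by (rule linear_mapI) auto
  then show ?thesis using assms by (intro equalizer_submodule) auto
qed

lemma bilinear_map_closed: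
  "\<lbrakk>bilinear_map K A B C f; a \<in> carrier A; b \<in> carrier B\<rbrakk> \<Longrightarrow> f a b \<in> carrier C"
  by (simp add: bilinear_map_def)

lemma bilinear_map_left:
  "\<lbrakk>bilinear_map K A B C f; b \<in> carrier B\<rbrakk> \<Longrightarrow> linear_map K A C (\<lambda>a. f a b)"
  by (simp add: bilinear_map_def linear_map_def)

lemma bilinear_map_right:
  "\<lbrakk>bilinear_map K A B C f; a \<in> carrier A\<rbrakk> \<Longrightarrow> linear_map K B C (f a)"
  by (simp add: bilinear_map_def linear_map_def)

lemma bilinear_map_compose:
  "\<lbrakk>bilinear_map K A B C t; linear_map K A' A f; linear_map K B' B g\<rbrakk> \<Longrightarrow>
    bilinear_map K A' B' C (\<lambda>a b. t (f a) (g b))"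
  by (simp add: bilinear_map_def linear_map_def)


section \<open>Free vector spaces\<close>

lemma free_vs_simps:
  "f \<in> carrier (free_vs K G) \<longleftrightarrow>
     (\<forall>g. f g \<in> carrier K) \<and> finite {g. f g \<noteq> \<zero>\<^bsub>K\<^esub>} \<and> (\<forall>g. f g \<noteq> \<zero>\<^bsub>K\<^esub> \<longrightarrow> g \<in> G)"
  "\<zero>\<^bsub>free_vs K G\<^esub> = (\<lambda>g. \<zero>\<^bsub>K\<^esub>)"
  "f \<oplus>\<^bsub>free_vs K G\<^esub> h = (\<lambda>g. f g \<oplus>\<^bsub>K\<^esub> h g)"
  "k \<odot>\<^bsub>free_vs K G\<^esub> f = (\<lambda>g. k \<otimes>\<^bsub>K\<^esub> f g)"
  by (auto simp: free_vs_def)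

lemma free_vs_module:
  assumes "cring K"
  shows "module K (free_vs K G)"
proof -
  interpret K: cring K by fact
  have add: "(\<lambda>g. x g \<oplus>\<^bsub>K\<^esub> y g) \<in> carrier (free_vs K G)"
    if "x \<in> carrier (free_vs K G)" "y \<in> carrier (free_vs K G)" for x y
  proof -
    have "{g. x g \<oplus>\<^bsub>K\<^esub> y g \<noteq> \<zero>\<^bsub>K\<^esub>} \<subseteq> {g. x g \<noteq> \<zero>\<^bsub>K\<^esub>} \<union> {g. y g \<noteq> \<zero>\<^bsub>K\<^esub>}" by auto
    then show ?thesis
      using that by (auto simp: free_vs_simps intro: finite_subset)
  qed
  have smult: "(\<lambda>g. k \<otimes>\<^bsub>K\<^esub> x g) \<in> carrier (free_vs K G)"
    if "k \<in> carrier K" "x \<in> carrier (free_vs K G)" for k x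
  proof -
    have "{g. k \<otimes>\<^bsub>K\<^esub> x g \<noteq> \<zero>\<^bsub>K\<^esub>} \<subseteq> {g. x g \<noteq> \<zero>\<^bsub>K\<^esub>}" using that(1) by auto
    then show ?thesis
      using that by (auto simp: free_vs_simps intro: finite_subset)
  qed
  have neg: "\<exists>y\<in>carrier (free_vs K G). y \<oplus>\<^bsub>free_vs K G\<^esub> x = \<zero>\<^bsub>free_vs K G\<^esub>"
    if "x \<in> carrier (free_vs K G)" for x
    using that smult[OF K.a_inv_closed[OF K.one_closed] that]
    by (intro bexI[of _ "\<lambda>g. \<ominus>\<^bsub>K\<^esub> \<one>\<^bsub>K\<^esub> \<otimes>\<^bsub>K\<^esub> x g"])
      (auto simp: free_vs_simps K.l_minus K.l_neg)
  have val: "x g \<in> carrier K" if "x \<in> carrier (free_vs K G)" for x g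
    using that by (simp add: free_vs_simps(1))
  show ?thesis
  proof (rule moduleI)
    show "abelian_group (free_vs K G)"
    proof (rule abelian_groupI)
      show "\<zero>\<^bsub>free_vs K G\<^esub> \<in> carrier (free_vs K G)" by (simp add: free_vs_simps)
      fix x assume x: "x \<in> carrier (free_vs K G)"
      show "\<zero>\<^bsub>free_vs K G\<^esub> \<oplus>\<^bsub>free_vs K G\<^esub> x = x" using val[OF x] by (simp add: free_vs_simps(2-4))
      show "\<exists>y\<in>carrier (free_vs K G). y \<oplus>\<^bsub>free_vs K G\<^esub> x = \<zero>\<^bsub>free_vs K G\<^esub>" by (rule neg[OF x])
      fix y assume y: "y \<in> carrier (free_vs K G)"
      show "x \<oplus>\<^bsub>free_vs K G\<^esub> y \<in> carrier (free_vs K G)"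
        unfolding free_vs_simps(3) by (rule add[OF x y])
      show "x \<oplus>\<^bsub>free_vs K G\<^esub> y = y \<oplus>\<^bsub>free_vs K G\<^esub> x"
        unfolding free_vs_simps(3) using val[OF x] val[OF y] by (intro ext K.a_comm)
      fix z assume z: "z \<in> carrier (free_vs K G)"
      show "x \<oplus>\<^bsub>free_vs K G\<^esub> y \<oplus>\<^bsub>free_vs K G\<^esub> z = x \<oplus>\<^bsub>free_vs K G\<^esub> (y \<oplus>\<^bsub>free_vs K G\<^esub> z)"
        unfolding free_vs_simps(3) using val[OF x] val[OF y] val[OF z] by (intro ext K.a_assoc)
    qed
    fix x assume x: "x \<in> carrier (free_vs K G)"
    show "\<one>\<^bsub>K\<^esub> \<odot>\<^bsub>free_vs K G\<^esub> x = x" using val[OF x] by (simp add: free_vs_simps(4))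
    fix k assume k: "k \<in> carrier K"
    show "k \<odot>\<^bsub>free_vs K G\<^esub> x \<in> carrier (free_vs K G)"
      unfolding free_vs_simps(4) by (rule smult[OF k x])
    fix l assume l: "l \<in> carrier K"
    show "(k \<oplus>\<^bsub>K\<^esub> l) \<odot>\<^bsub>free_vs K G\<^esub> x = k \<odot>\<^bsub>free_vs K G\<^esub> x \<oplus>\<^bsub>free_vs K G\<^esub> l \<odot>\<^bsub>free_vs K G\<^esub> x"
      unfolding free_vs_simps(3,4) using k l val[OF x] by (intro ext K.l_distr)
    show "(k \<otimes>\<^bsub>K\<^esub> l) \<odot>\<^bsub>free_vs K G\<^esub> x = k \<odot>\<^bsub>free_vs K G\<^esub> (l \<odot>\<^bsub>free_vs K G\<^esub> x)"
      unfolding free_vs_simps(4) using k l val[OF x] by (intro ext K.m_assoc)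
  next
    fix k x y
    assume k: "k \<in> carrier K" and xy: "x \<in> carrier (free_vs K G)" "y \<in> carrier (free_vs K G)"
    show "k \<odot>\<^bsub>free_vs K G\<^esub> (x \<oplus>\<^bsub>free_vs K G\<^esub> y)
        = k \<odot>\<^bsub>free_vs K G\<^esub> x \<oplus>\<^bsub>free_vs K G\<^esub> k \<odot>\<^bsub>free_vs K G\<^esub> y"
      unfolding free_vs_simps(3,4) using k val[OF xy(1)] val[OF xy(2)] by (intro ext K.r_distr)
  qed (rule assms)
qed

lemma sym_vec_closed:
  assumes "cring K" "g \<in> G"
  shows "sym_vec K g \<in> carrier (free_vs K G)"
proof -
  interpret K: cring K by fact
  have "{h. sym_vec K g h \<noteq> \<zero>\<^bsub>K\<^esub>} \<subseteq> {g}" by (auto simp: sym_vec_def)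
  then show ?thesis
    using assms(2) finite_subset[of _ "{g}"] by (auto simp: free_vs_simps sym_vec_def)
qed

text \<open>
  Removing one symbol from the support of a vector subtracts a multiple of that symbol, so induction
  on a finite set containing the support writes every vector in terms of the symbols.
\<close>

lemma free_vs_generated:
  assumes K: "cring K" and W: "submodule W K (free_vs K G)" and gen: "sym_vec K ` G \<subseteq> W"
    and v: "v \<in> carrier (free_vs K G)"
  shows "v \<in> W"
proof -
  interpret K: cring K by fact
  interpret F: module K "free_vs K G" by (rule free_vs_module[OF K])
  note W = F.submoduleE[OF W] subgroup.one_closed[OF submodule.axioms(1)[OF W], simplified]
  have "v \<in> W" if "finite S" "v \<in> carrier (free_vs K G)" "{g. v g \<noteq> \<zero>\<^bsub>K\<^esub>} \<subseteq> S" for S v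
    using that
  proof (induction S arbitrary: v rule: finite_induct)
    case empty
    then have "v = \<zero>\<^bsub>free_vs K G\<^esub>" by (auto simp: free_vs_simps)
    then show ?case using W(7) by simp
  next
    case (insert g S)
    show ?case
    proof (cases "v g = \<zero>\<^bsub>K\<^esub>")
      case True
      then show ?thesis using insert by (intro insert.IH) auto
    next
      case False
      then have "g \<in> G" using insert.prems by (auto simp: free_vs_simps)
      let ?u = "v(g := \<zero>\<^bsub>K\<^esub>)"
      have "{h. ?u h \<noteq> \<zero>\<^bsub>K\<^esub>} \<subseteq> {h. v h \<noteq> \<zero>\<^bsub>K\<^esub>}" by auto
      then have "?u \<in> carrier (free_vs K G)"
        using insert.prems(1) by (auto simp: free_vs_simps intro: finite_subset)
      moreover have "{h. ?u h \<noteq> \<zero>\<^bsub>K\<^esub>} \<subseteq> S" using insert.prems(2) by auto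
      ultimately have "?u \<in> W" by (rule insert.IH)
      moreover have "v g \<odot>\<^bsub>free_vs K G\<^esub> sym_vec K g \<in> W"
        using gen \<open>g \<in> G\<close> insert.prems(1) by (intro W(4)) (auto simp: free_vs_simps)
      ultimately have "?u \<oplus>\<^bsub>free_vs K G\<^esub> v g \<odot>\<^bsub>free_vs K G\<^esub> sym_vec K g \<in> W"
        by (rule W(5))
      moreover have "?u \<oplus>\<^bsub>free_vs K G\<^esub> v g \<odot>\<^bsub>free_vs K G\<^esub> sym_vec K g = v"
        using insert.prems(1) by (simp add: free_vs_simps sym_vec_def fun_eq_iff)
      ultimately show ?thesis by simp
    qed
  qed
  from this[of "{g. v g \<noteq> \<zero>\<^bsub>K\<^esub>}", OF _ v] show ?thesis
    using v by (simp add: free_vs_simps(1))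
qed

definition lin_ext ::
  "('k, 'r) ring_scheme \<Rightarrow> ('k, 'b, 'y) module_scheme \<Rightarrow> ('g \<Rightarrow> 'b) \<Rightarrow> ('g \<Rightarrow> 'k) \<Rightarrow> 'b" where
  "lin_ext K B f v = (\<Oplus>\<^bsub>B\<^esub>g\<in>{g. v g \<noteq> \<zero>\<^bsub>K\<^esub>}. v g \<odot>\<^bsub>B\<^esub> f g)"

text \<open>
  The sum defining \<open>lin_ext\<close> runs over the support, which depends on \<open>v\<close>. Before the sums of several
  vectors are compared, they are extended to a common finite set.
\<close>

lemma lin_ext_superset:
  assumes "module K B" and f: "f \<in> G \<rightarrow> carrier B"
    and "v \<in> carrier (free_vs K G)"
    and "finite S" "{g. v g \<noteq> \<zero>\<^bsub>K\<^esub>} \<subseteq> S" "S \<subseteq> G"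
  shows "lin_ext K B f v = (\<Oplus>\<^bsub>B\<^esub>g\<in>S. v g \<odot>\<^bsub>B\<^esub> f g)"
proof -
  interpret B: module K B by fact
  have fv: "f g \<in> carrier B" "v g \<in> carrier K" if "g \<in> S" for g
    using funcset_mem[OF f subsetD[OF assms(6) that]] assms(3) by (simp_all add: free_vs_simps(1))
  show ?thesis unfolding lin_ext_def
  proof (rule B.add.finprod_mono_neutral_cong_left)
    show "v g \<odot>\<^bsub>B\<^esub> f g = \<zero>\<^bsub>B\<^esub>" if "g \<in> S - {g. v g \<noteq> \<zero>\<^bsub>K\<^esub>}" for g
      using that fv by simp
    show "(\<lambda>g. v g \<odot>\<^bsub>B\<^esub> f g) \<in> S \<rightarrow> carrier B" using fv by simp
  qed (use assms(4,5) in simp_all)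
qed

lemma lin_ext_linear:
  assumes "module K B" "f \<in> G \<rightarrow> carrier B"
  shows "linear_map K (free_vs K G) B (lin_ext K B f)"
proof -
  interpret B: module K B by fact
  interpret F: module K "free_vs K G" by (rule free_vs_module) unfold_locales
  note sup = lin_ext_superset[OF assms]
  have supp: "finite {g. v g \<noteq> \<zero>\<^bsub>K\<^esub>}" "{g. v g \<noteq> \<zero>\<^bsub>K\<^esub>} \<subseteq> G" "\<And>g. v g \<in> carrier K"
    if "v \<in> carrier (free_vs K G)" for v
    using that by (auto simp: free_vs_simps)
  show ?thesis
  proof (rule linear_mapI)
    fix v assume v: "v \<in> carrier (free_vs K G)"
    show "lin_ext K B f v \<in> carrier B"
      unfolding lin_ext_def using supp[OF v] assms(2) by (intro B.finsum_closed) auto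
    fix k assume k: "k \<in> carrier K"
    let ?S = "{g. v g \<noteq> \<zero>\<^bsub>K\<^esub>}"
    have fS: "f g \<in> carrier B" if "g \<in> ?S" for g
      by (rule funcset_mem[OF assms(2) subsetD[OF supp(2)[OF v] that]])
    have "lin_ext K B f (k \<odot>\<^bsub>free_vs K G\<^esub> v)
        = (\<Oplus>\<^bsub>B\<^esub>g\<in>?S. (k \<otimes>\<^bsub>K\<^esub> v g) \<odot>\<^bsub>B\<^esub> f g)"
      using supp[OF v] k by (subst sup[OF F.smult_closed[OF k v], of ?S]) (auto simp: free_vs_simps(4))
    also have "\<dots> = (\<Oplus>\<^bsub>B\<^esub>g\<in>?S. k \<odot>\<^bsub>B\<^esub> (v g \<odot>\<^bsub>B\<^esub> f g))"
      using supp(3)[OF v] k fS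
      by (intro B.finsum_cong') (simp_all add: B.smult_assoc1 Pi_iff)
    also have "\<dots> = k \<odot>\<^bsub>B\<^esub> lin_ext K B f v"
      unfolding lin_ext_def using supp[OF v] k fS
      by (intro B.finsum_smult_ldistr[symmetric]) (simp_all add: Pi_iff)
    finally show "lin_ext K B f (k \<odot>\<^bsub>free_vs K G\<^esub> v) = k \<odot>\<^bsub>B\<^esub> lin_ext K B f v" .
  next
    fix v w assume v: "v \<in> carrier (free_vs K G)" and w: "w \<in> carrier (free_vs K G)"
    let ?S = "{g. v g \<noteq> \<zero>\<^bsub>K\<^esub>} \<union> {g. w g \<noteq> \<zero>\<^bsub>K\<^esub>}"
    have S: "finite ?S" "?S \<subseteq> G" using supp[OF v] supp[OF w] by auto
    have fS: "f g \<in> carrier B" if "g \<in> ?S" for g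
      by (rule funcset_mem[OF assms(2) subsetD[OF S(2) that]])
    have terms: "(\<lambda>g. v g \<odot>\<^bsub>B\<^esub> f g) \<in> ?S \<rightarrow> carrier B" "(\<lambda>g. w g \<odot>\<^bsub>B\<^esub> f g) \<in> ?S \<rightarrow> carrier B"
      using fS supp(3)[OF v] supp(3)[OF w] by (simp_all add: Pi_iff)
    have "lin_ext K B f (v \<oplus>\<^bsub>free_vs K G\<^esub> w) = (\<Oplus>\<^bsub>B\<^esub>g\<in>?S. (v g \<oplus>\<^bsub>K\<^esub> w g) \<odot>\<^bsub>B\<^esub> f g)"
      using S by (subst sup[OF F.a_closed[OF v w], of ?S]) (auto simp: free_vs_simps(3))
    also have "\<dots> = (\<Oplus>\<^bsub>B\<^esub>g\<in>?S. v g \<odot>\<^bsub>B\<^esub> f g \<oplus>\<^bsub>B\<^esub> w g \<odot>\<^bsub>B\<^esub> f g)"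
      using terms fS supp(3)[OF v] supp(3)[OF w]
      by (intro B.finsum_cong') (simp_all add: B.smult_l_distr Pi_iff)
    also have "\<dots> = (\<Oplus>\<^bsub>B\<^esub>g\<in>?S. v g \<odot>\<^bsub>B\<^esub> f g) \<oplus>\<^bsub>B\<^esub> (\<Oplus>\<^bsub>B\<^esub>g\<in>?S. w g \<odot>\<^bsub>B\<^esub> f g)"
      using terms by (rule B.finsum_addf)
    also have "\<dots> = lin_ext K B f v \<oplus>\<^bsub>B\<^esub> lin_ext K B f w"
      by (simp only: sup[OF v S(1) Un_upper1 S(2)] sup[OF w S(1) Un_upper2 S(2)])
    finally show "lin_ext K B f (v \<oplus>\<^bsub>free_vs K G\<^esub> w) = lin_ext K B f v \<oplus>\<^bsub>B\<^esub> lin_ext K B f w" .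
  qed
qed

lemma lin_ext_sym_vec:
  assumes "module K B" "f \<in> G \<rightarrow> carrier B" "g \<in> G"
  shows "lin_ext K B f (sym_vec K g) = f g"
proof -
  interpret B: module K B by fact
  have fg: "f g \<in> carrier B" using assms by auto
  have "lin_ext K B f (sym_vec K g) = (\<Oplus>\<^bsub>B\<^esub>h\<in>{g}. sym_vec K g h \<odot>\<^bsub>B\<^esub> f h)"
    using assms by (intro lin_ext_superset[OF assms(1,2) sym_vec_closed])
      (auto simp: sym_vec_def B.R.cring_axioms)
  also have "\<dots> = sym_vec K g g \<odot>\<^bsub>B\<^esub> f g"
    using fg by (subst B.finsum_insert) (auto simp: sym_vec_def)
  also have "\<dots> = f g" using fg by (simp add: sym_vec_def)
  finally show ?thesis .
qed


section \<open>Quotient spaces\<close>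

lemma submodule_abelian_subgroup:
  assumes "module K V" "submodule W K V"
  shows "abelian_subgroup W V"
proof -
  interpret V: module K V by fact
  show ?thesis
    using submodule.axioms(1)[OF assms(2)] V.a_comm_group by (rule abelian_subgroupI2[rotated])
qed

lemma quotient_vs_carrier:
  "carrier (quotient_vs V W) = (\<lambda>x. W +>\<^bsub>V\<^esub> x) ` carrier V"
  by (auto simp: quotient_vs_def A_RCOSETS_def' a_r_coset_def')

lemma coset_eq_iff:
  assumes "module K V" "submodule W K V" "x \<in> carrier V" "y \<in> carrier V"
  shows "W +>\<^bsub>V\<^esub> x = W +>\<^bsub>V\<^esub> y \<longleftrightarrow> x \<ominus>\<^bsub>V\<^esub> y \<in> W"
proof -
  interpret V: module K V by fact
  interpret W: abelian_subgroup W V by (rule submodule_abelian_subgroup[OF assms(1,2)])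
  show ?thesis
    using W.a_rcos_module[OF assms(4,3)] W.a_repr_independence'[OF _ assms(4), of x]
      W.a_rcos_self[OF assms(3)] by (auto simp: V.minus_eq)
qed

lemma quotient_vs_add:
  assumes "module K V" "submodule W K V" "x \<in> carrier V" "y \<in> carrier V"
  shows "(W +>\<^bsub>V\<^esub> x) \<oplus>\<^bsub>quotient_vs V W\<^esub> (W +>\<^bsub>V\<^esub> y) = W +>\<^bsub>V\<^esub> (x \<oplus>\<^bsub>V\<^esub> y)"
  using abelian_subgroup.a_rcos_sum[OF submodule_abelian_subgroup[OF assms(1,2)] assms(3,4)]
  by (simp add: quotient_vs_def)

text \<open>
  The scalar multiple of a coset is defined as a union over all its representatives. It is a single
  coset because the submodule is closed under multiplication by \<open>k\<close>.
\<close>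

lemma quotient_vs_smult:
  assumes "module K V" "submodule W K V" "k \<in> carrier K" "x \<in> carrier V"
  shows "k \<odot>\<^bsub>quotient_vs V W\<^esub> (W +>\<^bsub>V\<^esub> x) = W +>\<^bsub>V\<^esub> (k \<odot>\<^bsub>V\<^esub> x)"
proof -
  interpret V: module K V by fact
  interpret W: abelian_subgroup W V by (rule submodule_abelian_subgroup[OF assms(1,2)])
  have const: "W +>\<^bsub>V\<^esub> (k \<odot>\<^bsub>V\<^esub> y) = W +>\<^bsub>V\<^esub> (k \<odot>\<^bsub>V\<^esub> x)" if y: "y \<in> W +>\<^bsub>V\<^esub> x" for y
  proof -
    have yc: "y \<in> carrier V" using W.a_elemrcos_carrier[OF assms(4) y] .
    then have "y \<ominus>\<^bsub>V\<^esub> x \<in> W" using W.a_rcos_module[OF assms(4)] y by (simp add: V.minus_eq)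
    then have "k \<odot>\<^bsub>V\<^esub> (y \<ominus>\<^bsub>V\<^esub> x) \<in> W" using V.submoduleE(4)[OF assms(2,3)] by auto
    then have "k \<odot>\<^bsub>V\<^esub> y \<ominus>\<^bsub>V\<^esub> k \<odot>\<^bsub>V\<^esub> x \<in> W"
      using assms yc by (simp add: V.minus_eq V.smult_r_distr V.smult_r_minus)
    then show ?thesis using coset_eq_iff[OF assms(1,2)] assms yc by simp
  qed
  have "(\<Union>y\<in>W +>\<^bsub>V\<^esub> x. W +>\<^bsub>V\<^esub> (k \<odot>\<^bsub>V\<^esub> y)) = W +>\<^bsub>V\<^esub> (k \<odot>\<^bsub>V\<^esub> x)"
    by (rule UN_constant_eq[OF W.a_rcos_self[OF assms(4)] ballI]) (rule const)
  then show ?thesis by (simp add: quotient_vs_def)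
qed

lemma quotient_vs_zero:
  assumes "module K V" "submodule W K V"
  shows "\<zero>\<^bsub>quotient_vs V W\<^esub> = W +>\<^bsub>V\<^esub> \<zero>\<^bsub>V\<^esub>"
proof -
  interpret V: module K V by fact
  show ?thesis using V.submoduleE(1)[OF assms(2)] by (simp add: quotient_vs_def)
qed

lemma quotient_vs_module:
  assumes "module K V" "submodule W K V"
  shows "module K (quotient_vs V W)"
proof -
  interpret V: module K V by fact
  note simps = quotient_vs_carrier quotient_vs_add[OF assms] quotient_vs_smult[OF assms]
    quotient_vs_zero[OF assms]
  show ?thesis
  proof (rule moduleI)
    show "abelian_group (quotient_vs V W)"
    proof (rule abelian_groupI)
      fix x assume "x \<in> carrier (quotient_vs V W)"
      then obtain v where "v \<in> carrier V" "x = W +>\<^bsub>V\<^esub> v" by (auto simp: simps)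
      then show "\<exists>y\<in>carrier (quotient_vs V W). y \<oplus>\<^bsub>quotient_vs V W\<^esub> x = \<zero>\<^bsub>quotient_vs V W\<^esub>"
        by (intro bexI[of _ "W +>\<^bsub>V\<^esub> (\<ominus>\<^bsub>V\<^esub> v)"]) (auto simp: simps V.l_neg)
    qed (auto simp: simps V.a_ac)
  qed (auto simp: simps V.R.cring_axioms V.smult_l_distr V.smult_r_distr V.smult_assoc1)
qed

lemma coset_linear:
  assumes "module K V" "submodule W K V"
  shows "linear_map K V (quotient_vs V W) (\<lambda>x. W +>\<^bsub>V\<^esub> x)"
  by (rule linear_mapI)
    (auto simp: quotient_vs_carrier quotient_vs_add[OF assms] quotient_vs_smult[OF assms])

lemma quotient_vs_lift:
  assumes V: "module K V" and W: "submodule W K V" and B: "module K B"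
    and f: "linear_map K V B f" and van: "\<And>x. x \<in> W \<Longrightarrow> f x = \<zero>\<^bsub>B\<^esub>"
  obtains h where "linear_map K (quotient_vs V W) B h"
    and "\<And>x. x \<in> carrier V \<Longrightarrow> h (W +>\<^bsub>V\<^esub> x) = f x"
proof -
  interpret V: module K V by fact
  interpret B: module K B by fact
  define h where "h X = f (SOME x. x \<in> carrier V \<and> W +>\<^bsub>V\<^esub> x = X)" for X
  have h: "h (W +>\<^bsub>V\<^esub> x) = f x" if x: "x \<in> carrier V" for x
  proof -
    define y where "y = (SOME y. y \<in> carrier V \<and> W +>\<^bsub>V\<^esub> y = W +>\<^bsub>V\<^esub> x)"
    have y: "y \<in> carrier V \<and> W +>\<^bsub>V\<^esub> y = W +>\<^bsub>V\<^esub> x"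
      unfolding y_def by (rule someI[of _ x]) (simp add: x)
    then have "y \<ominus>\<^bsub>V\<^esub> x \<in> W" using coset_eq_iff[OF V W] x by blast
    then have "f y \<ominus>\<^bsub>B\<^esub> f x = \<zero>\<^bsub>B\<^esub>"
      using van linear_map_diff[OF V B f] x y by metis
    then have "\<ominus>\<^bsub>B\<^esub> (\<ominus>\<^bsub>B\<^esub> f x) = f y"
      using linear_mapD(1)[OF f] x y by (intro B.minus_equality) (auto simp: B.minus_eq)
    then have "f y = f x" using linear_mapD(1)[OF f x] by simp
    then show ?thesis by (simp add: h_def y_def)
  qed
  have "linear_map K (quotient_vs V W) B h"
    using linear_mapD[OF f]
    by (intro linear_mapI) (auto simp: quotient_vs_carrier quotient_vs_add[OF V W]
        quotient_vs_smult[OF V W] h)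
  then show ?thesis using h that by blast
qed

text \<open>
  The hull is an intersection of submodules. Inclusion of \<open>S\<close> in the carrier ensures that
  at least one submodule takes part, without which the intersection would be the whole type.
\<close>

lemma hull_submodule:
  assumes "module K V" "S \<subseteq> carrier V"
  shows "submodule ((\<lambda>W. submodule W K V) hull S) K V"
proof -
  interpret V: module K V by fact
  have "\<zero>\<^bsub>V\<^esub> \<in> W" if "submodule W K V" for W
    using subgroup.one_closed[OF submodule.axioms(1)[OF that]] by simp
  then show ?thesis
    using V.carrier_is_submodule assms V.submoduleE(4,5)
    by (intro submodule_by_closure) (auto simp: hull_def)
qed


section \<open>Compatible actions\<close>

lemma basic_pairs_iff:
  "u \<in> basic_pairs M N aMN aNM \<longleftrightarrow> (\<exists>m\<in>carrier M. \<exists>n\<in>carrier N.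
     u \<in> {(rdot aNM m n, ldot aMN m n), (ldot aNM n m, rdot aMN n m),
          (rstar aNM m n, lstar aMN m n), (lstar aNM n m, rstar aMN n m)})"
  unfolding basic_pairs_def gens_def by (simp add: image_UN)

lemma basic_pairs_swap:
  "(v, u) \<in> basic_pairs N M aNM aMN \<longleftrightarrow> (u, v) \<in> basic_pairs M N aMN aNM"
  unfolding basic_pairs_iff by auto

lemma basic_pairs_closed:
  assumes "awb_action K M N aMN" "awb_action K N M aNM" "(u, v) \<in> basic_pairs M N aMN aNM"
  shows "u \<in> carrier M" "v \<in> carrier N"
  using assms(3)
    awb_action.ldot_bilinear[OF assms(1), THEN bilinear_map_closed]
    awb_action.rdot_bilinear[OF assms(1), THEN bilinear_map_closed]
    awb_action.lstar_bilinear[OF assms(1), THEN bilinear_map_closed]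
    awb_action.rstar_bilinear[OF assms(1), THEN bilinear_map_closed]
    awb_action.ldot_bilinear[OF assms(2), THEN bilinear_map_closed]
    awb_action.rdot_bilinear[OF assms(2), THEN bilinear_map_closed]
    awb_action.lstar_bilinear[OF assms(2), THEN bilinear_map_closed]
    awb_action.rstar_bilinear[OF assms(2), THEN bilinear_map_closed]
  unfolding basic_pairs_iff by auto

lemma compatibleD_all:
  assumes "compatible M N aMN aNM" "(u, v) \<in> basic_pairs M N aMN aNM" "m \<in> carrier M" "n \<in> carrier N"
  shows "rdot aNM m v = m \<otimes>\<^bsub>M\<^esub> u" "rstar aNM m v = bracket M m u"
    and "ldot aNM v m = u \<otimes>\<^bsub>M\<^esub> m" "lstar aNM v m = bracket M u m"
    and "ldot aMN u n = v \<otimes>\<^bsub>N\<^esub> n" "lstar aMN u n = bracket N v n"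
    and "rdot aMN n u = n \<otimes>\<^bsub>N\<^esub> v" "rstar aMN n u = bracket N n v"
  using bspec[OF bspec[OF bspec[OF assms(1)[unfolded compatible_def] assms(2), unfolded prod.case]
        assms(3)] assms(4)]
  by blast+

text \<open>
  Compatibility does not distinguish the two algebras, so what is proved about the component in \<open>M\<close>
  holds for the component in \<open>N\<close> as well.
\<close>

lemma compatible_swap:
  assumes "compatible M N aMN aNM"
  shows "compatible N M aNM aMN"
proof -
  have "rdot aMN n u = n \<otimes>\<^bsub>N\<^esub> v \<and> rstar aMN n u = bracket N n v \<and>
        ldot aNM v m = u \<otimes>\<^bsub>M\<^esub> m \<and> lstar aNM v m = bracket M u m \<and>
        rdot aNM m v = m \<otimes>\<^bsub>M\<^esub> u \<and> rstar aNM m v = bracket M m u \<and>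
        ldot aMN u n = v \<otimes>\<^bsub>N\<^esub> n \<and> lstar aMN u n = bracket N v n"
    if "(v, u) \<in> basic_pairs N M aNM aMN" "n \<in> carrier N" "m \<in> carrier M" for u v m n
    using compatibleD_all[OF assms basic_pairs_swap[THEN iffD1, OF that(1)] that(3,2)] by blast
  then show ?thesis unfolding compatible_def by blast
qed

lemma compatibleD:
  assumes "compatible M N aMN aNM" "(u, v) \<in> basic_pairs M N aMN aNM" "m \<in> carrier M"
  shows "rdot aNM m v = m \<otimes>\<^bsub>M\<^esub> u" "rstar aNM m v = bracket M m u"
    and "ldot aNM v m = u \<otimes>\<^bsub>M\<^esub> m" "lstar aNM v m = bracket M u m"
proof -
  obtain n where "n \<in> carrier N" using assms(2) by (auto simp: basic_pairs_iff)
  from compatibleD_all[OF assms this]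
  show "rdot aNM m v = m \<otimes>\<^bsub>M\<^esub> u" "rstar aNM m v = bracket M m u"
    "ldot aNM v m = u \<otimes>\<^bsub>M\<^esub> m" "lstar aNM v m = bracket M u m" by blast+
qed

text \<open>
  The equations of compatibility for each form of basic pair, as rewrite rules that remove
  iterated actions in favour of the product and bracket.
\<close>

lemma compatible_basic:
  assumes "compatible M N aMN aNM" "m \<in> carrier M" "m' \<in> carrier M" "n \<in> carrier N"
  shows "rdot aNM m (ldot aMN m' n) = m \<otimes>\<^bsub>M\<^esub> rdot aNM m' n"
    and "ldot aNM (ldot aMN m' n) m = rdot aNM m' n \<otimes>\<^bsub>M\<^esub> m"
    and "lstar aNM (ldot aMN m' n) m = bracket M (rdot aNM m' n) m"
    and "ldot aNM (rdot aMN n m') m = ldot aNM n m' \<otimes>\<^bsub>M\<^esub> m"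
    and "rdot aNM m (rdot aMN n m') = m \<otimes>\<^bsub>M\<^esub> ldot aNM n m'"
    and "lstar aNM (rdot aMN n m') m = bracket M (ldot aNM n m') m"
    and "rdot aNM m (lstar aMN m' n) = m \<otimes>\<^bsub>M\<^esub> rstar aNM m' n"
    and "ldot aNM (lstar aMN m' n) m = rstar aNM m' n \<otimes>\<^bsub>M\<^esub> m"
    and "rdot aNM m (rstar aMN n m') = m \<otimes>\<^bsub>M\<^esub> lstar aNM n m'"
    and "ldot aNM (rstar aMN n m') m = lstar aNM n m' \<otimes>\<^bsub>M\<^esub> m"
proof -
  have pairs: "(rdot aNM m' n, ldot aMN m' n) \<in> basic_pairs M N aMN aNM"
    "(ldot aNM n m', rdot aMN n m') \<in> basic_pairs M N aMN aNM"
    "(rstar aNM m' n, lstar aMN m' n) \<in> basic_pairs M N aMN aNM"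
    "(lstar aNM n m', rstar aMN n m') \<in> basic_pairs M N aMN aNM"
    using assms(3,4) by (auto simp: basic_pairs_iff)
  note D = compatibleD[OF assms(1) _ assms(2)]
  show "rdot aNM m (ldot aMN m' n) = m \<otimes>\<^bsub>M\<^esub> rdot aNM m' n"
    "ldot aNM (ldot aMN m' n) m = rdot aNM m' n \<otimes>\<^bsub>M\<^esub> m"
    "lstar aNM (ldot aMN m' n) m = bracket M (rdot aNM m' n) m"
    "ldot aNM (rdot aMN n m') m = ldot aNM n m' \<otimes>\<^bsub>M\<^esub> m"
    "rdot aNM m (rdot aMN n m') = m \<otimes>\<^bsub>M\<^esub> ldot aNM n m'"
    "lstar aNM (rdot aMN n m') m = bracket M (ldot aNM n m') m"
    "rdot aNM m (lstar aMN m' n) = m \<otimes>\<^bsub>M\<^esub> rstar aNM m' n"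
    "ldot aNM (lstar aMN m' n) m = rstar aNM m' n \<otimes>\<^bsub>M\<^esub> m"
    "rdot aNM m (rstar aMN n m') = m \<otimes>\<^bsub>M\<^esub> lstar aNM n m'"
    "ldot aNM (rstar aMN n m') m = lstar aNM n m' \<otimes>\<^bsub>M\<^esub> m"
    using D[OF pairs(1)] D[OF pairs(2)] D[OF pairs(3)] D[OF pairs(4)] by simp_all
qed


section \<open>The defining relations of \<open>M \<boxtimes> N\<close> hold for the associated pairs\<close>

text \<open>
  Apart from those between basic pairs, the relations of \<open>M \<boxtimes> N\<close> form two halves that differ only by exchanging the two algebras.
  Abstracting from the four families of symbols lets each statement about one half serve for both.
\<close>

locale symbol_families =
  fixes K :: "('k, 'r) ring_scheme" and A :: "('k, 'a, 'x) awb_scheme"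
    and B :: "('k, 'b, 'y) awb_scheme" and act :: "('a, 'b) action"
    and F :: "('k, 'v, 'z) module_scheme"
    and d :: "'a \<Rightarrow> 'b \<Rightarrow> 'v" and d' :: "'b \<Rightarrow> 'a \<Rightarrow> 'v"
    and s :: "'a \<Rightarrow> 'b \<Rightarrow> 'v" and s' :: "'b \<Rightarrow> 'a \<Rightarrow> 'v"
  assumes act: "awb_action K A B act" and F: "module K F"
    and symbols: "\<And>a b. \<lbrakk>a \<in> carrier A; b \<in> carrier B\<rbrakk> \<Longrightarrow>
      d a b \<in> carrier F \<and> d' b a \<in> carrier F \<and> s a b \<in> carrier F \<and> s' b a \<in> carrier F"
begin

lemmas symbol_closed = symbols[THEN conjunct1] symbols[THEN conjunct2, THEN conjunct1]
  symbols[THEN conjunct2, THEN conjunct2, THEN conjunct1]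
  symbols[THEN conjunct2, THEN conjunct2, THEN conjunct2]

lemma awbs: "awb K A" "awb K B"
  using awb_action.axioms[OF act] by auto

lemma modules: "module K A" "module K B"
  using awbs awb.axioms by auto

lemma operation_closed:
  "\<lbrakk>a \<in> carrier A; a' \<in> carrier A\<rbrakk> \<Longrightarrow> a \<oplus>\<^bsub>A\<^esub> a' \<in> carrier A"
  "\<lbrakk>a \<in> carrier A; a' \<in> carrier A\<rbrakk> \<Longrightarrow> a \<otimes>\<^bsub>A\<^esub> a' \<in> carrier A"
  "\<lbrakk>a \<in> carrier A; a' \<in> carrier A\<rbrakk> \<Longrightarrow> bracket A a a' \<in> carrier A"
  "\<lbrakk>k \<in> carrier K; a \<in> carrier A\<rbrakk> \<Longrightarrow> k \<odot>\<^bsub>A\<^esub> a \<in> carrier A"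
  "\<lbrakk>b \<in> carrier B; b' \<in> carrier B\<rbrakk> \<Longrightarrow> b \<oplus>\<^bsub>B\<^esub> b' \<in> carrier B"
  "\<lbrakk>k \<in> carrier K; b \<in> carrier B\<rbrakk> \<Longrightarrow> k \<odot>\<^bsub>B\<^esub> b \<in> carrier B"
  "\<lbrakk>x \<in> carrier F; y \<in> carrier F\<rbrakk> \<Longrightarrow> x \<oplus>\<^bsub>F\<^esub> y \<in> carrier F"
  "\<lbrakk>k \<in> carrier K; x \<in> carrier F\<rbrakk> \<Longrightarrow> k \<odot>\<^bsub>F\<^esub> x \<in> carrier F"
  "\<lbrakk>a \<in> carrier A; b \<in> carrier B\<rbrakk> \<Longrightarrow> ldot act a b \<in> carrier B"
  "\<lbrakk>a \<in> carrier A; b \<in> carrier B\<rbrakk> \<Longrightarrow> rdot act b a \<in> carrier B"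
  "\<lbrakk>a \<in> carrier A; b \<in> carrier B\<rbrakk> \<Longrightarrow> lstar act a b \<in> carrier B"
  "\<lbrakk>a \<in> carrier A; b \<in> carrier B\<rbrakk> \<Longrightarrow> rstar act b a \<in> carrier B"
proof -
  interpret A: module K A by (rule modules)
  interpret B: module K B by (rule modules)
  interpret F: module K F by (rule F)
  show "\<lbrakk>a \<in> carrier A; a' \<in> carrier A\<rbrakk> \<Longrightarrow> a \<oplus>\<^bsub>A\<^esub> a' \<in> carrier A"
    "\<lbrakk>k \<in> carrier K; a \<in> carrier A\<rbrakk> \<Longrightarrow> k \<odot>\<^bsub>A\<^esub> a \<in> carrier A"
    "\<lbrakk>b \<in> carrier B; b' \<in> carrier B\<rbrakk> \<Longrightarrow> b \<oplus>\<^bsub>B\<^esub> b' \<in> carrier B"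
    "\<lbrakk>k \<in> carrier K; b \<in> carrier B\<rbrakk> \<Longrightarrow> k \<odot>\<^bsub>B\<^esub> b \<in> carrier B"
    "\<lbrakk>x \<in> carrier F; y \<in> carrier F\<rbrakk> \<Longrightarrow> x \<oplus>\<^bsub>F\<^esub> y \<in> carrier F"
    "\<lbrakk>k \<in> carrier K; x \<in> carrier F\<rbrakk> \<Longrightarrow> k \<odot>\<^bsub>F\<^esub> x \<in> carrier F"
    by simp_all
  show "\<lbrakk>a \<in> carrier A; a' \<in> carrier A\<rbrakk> \<Longrightarrow> a \<otimes>\<^bsub>A\<^esub> a' \<in> carrier A"
    "\<lbrakk>a \<in> carrier A; a' \<in> carrier A\<rbrakk> \<Longrightarrow> bracket A a a' \<in> carrier A"
    by (rule bilinear_map_closed[OF awb.mult_bilinear[OF awbs(1)]]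
        bilinear_map_closed[OF awb.bracket_bilinear[OF awbs(1)]]; assumption)+
  show "\<lbrakk>a \<in> carrier A; b \<in> carrier B\<rbrakk> \<Longrightarrow> ldot act a b \<in> carrier B"
    "\<lbrakk>a \<in> carrier A; b \<in> carrier B\<rbrakk> \<Longrightarrow> rdot act b a \<in> carrier B"
    "\<lbrakk>a \<in> carrier A; b \<in> carrier B\<rbrakk> \<Longrightarrow> lstar act a b \<in> carrier B"
    "\<lbrakk>a \<in> carrier A; b \<in> carrier B\<rbrakk> \<Longrightarrow> rstar act b a \<in> carrier B"
    by (rule bilinear_map_closed[OF awb_action.ldot_bilinear[OF act]]
        bilinear_map_closed[OF awb_action.rdot_bilinear[OF act]]
        bilinear_map_closed[OF awb_action.lstar_bilinear[OF act]]
        bilinear_map_closed[OF awb_action.rstar_bilinear[OF act]]; assumption)+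
qed

lemma half_relations_closed:
  assumes "(x, y) \<in> half_relations K A B act F d d' s s'"
  shows "x \<in> carrier F \<and> y \<in> carrier F"
  using assms by cases (auto intro!: operation_closed symbol_closed)

text \<open>
  The component in the algebra \<open>A\<close> that acts in these relations. Compatibility turns both sides into
  expressions in the product and bracket of \<open>A\<close> and the action of \<open>B\<close> on \<open>A\<close>, and the two agree by the
  axioms of an action that involve two elements of the algebra acted upon. The relations of
  bilinearity follow from the bilinearity of the action of \<open>B\<close>.
\<close>

lemma half_relations_first:
  assumes bct: "awb_action K B A bct" and comp: "compatible A B act bct"
    and h: "linear_map K F A h"
    and hd: "\<And>a b. \<lbrakk>a \<in> carrier A; b \<in> carrier B\<rbrakk> \<Longrightarrow> h (d a b) = rdot bct a b"
    and hd': "\<And>a b. \<lbrakk>a \<in> carrier A; b \<in> carrier B\<rbrakk> \<Longrightarrow> h (d' b a) = ldot bct b a"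
    and hs: "\<And>a b. \<lbrakk>a \<in> carrier A; b \<in> carrier B\<rbrakk> \<Longrightarrow> h (s a b) = rstar bct a b"
    and hs': "\<And>a b. \<lbrakk>a \<in> carrier A; b \<in> carrier B\<rbrakk> \<Longrightarrow> h (s' b a) = lstar bct b a"
    and xy: "(x, y) \<in> half_relations K A B act F d d' s s'"
  shows "h x = h y"
proof -
  note lin = awb_action.ldot_bilinear[OF bct] awb_action.rdot_bilinear[OF bct]
    awb_action.lstar_bilinear[OF bct] awb_action.rstar_bilinear[OF bct]
  note simps = linear_mapD[OF h] operation_closed symbol_closed hd hd' hs hs'
    compatible_basic[OF comp] awb_action.act_axioms2[OF bct]
  show ?thesis
    using xy
  proof cases
    case smult_left
    then show ?thesis using lin by (auto simp: simps bilinear_map_def)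
  next
    case smult_right
    then show ?thesis using lin by (auto simp: simps bilinear_map_def)
  next
    case add_left
    then show ?thesis using lin by (auto simp: simps bilinear_map_def)
  next
    case add_right
    then show ?thesis using lin by (auto simp: simps bilinear_map_def)
  next
    (* the only relation whose two summands come in the opposite order in the action axiom *)
    case (rdot_star a1 a2 b)
    interpret A: module K A by (rule modules)
    have "ldot bct b (bracket A a1 a2) \<in> carrier A" "lstar bct b a2 \<otimes>\<^bsub>A\<^esub> a1 \<in> carrier A"
      using rdot_star(3-5) lin(1,3) by (simp_all add: operation_closed bilinear_map_def)
    from A.a_comm[OF this] show ?thesis using rdot_star by (simp add: simps)
  qed (simp_all add: simps)
qed

text \<open>
  The component in the algebra \<open>B\<close> that is acted upon. Every relation becomes
  an instance of bilinearity or of an axiom of an action that involves two elements of the acting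
  algebra.
\<close>

lemma half_relations_second:
  assumes h: "linear_map K F B h"
    and hd: "\<And>a b. \<lbrakk>a \<in> carrier A; b \<in> carrier B\<rbrakk> \<Longrightarrow> h (d a b) = ldot act a b"
    and hd': "\<And>a b. \<lbrakk>a \<in> carrier A; b \<in> carrier B\<rbrakk> \<Longrightarrow> h (d' b a) = rdot act b a"
    and hs: "\<And>a b. \<lbrakk>a \<in> carrier A; b \<in> carrier B\<rbrakk> \<Longrightarrow> h (s a b) = lstar act a b"
    and hs': "\<And>a b. \<lbrakk>a \<in> carrier A; b \<in> carrier B\<rbrakk> \<Longrightarrow> h (s' b a) = rstar act b a"
    and xy: "(x, y) \<in> half_relations K A B act F d d' s s'"
  shows "h x = h y"
proof -
  note lin = awb_action.ldot_bilinear[OF act] awb_action.rdot_bilinear[OF act]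
    awb_action.lstar_bilinear[OF act] awb_action.rstar_bilinear[OF act]
  note simps = linear_mapD[OF h] operation_closed symbol_closed hd hd' hs hs'
    awb_action.act_axioms1[OF act]
  show ?thesis
    using xy
  proof cases
    case smult_left
    then show ?thesis using lin by (auto simp: simps bilinear_map_def)
  next
    case smult_right
    then show ?thesis using lin by (auto simp: simps bilinear_map_def)
  next
    case add_left
    then show ?thesis using lin by (auto simp: simps bilinear_map_def)
  next
    case add_right
    then show ?thesis using lin by (auto simp: simps bilinear_map_def)
  qed (simp_all add: simps)
qed

lemma half_relations_bilinear:
  assumes h: "linear_map K F V h" and t: "t \<in> {d, s}"
    and rel: "\<And>x y. (x, y) \<in> half_relations K A B act F d d' s s' \<Longrightarrow> h x = h y"
  shows "bilinear_map K A B V (\<lambda>a b. h (t a b))"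
proof -
  note lin = linear_mapD[OF h]
  have t_closed: "t a b \<in> carrier F" if "a \<in> carrier A" "b \<in> carrier B" for a b
    using t symbols[OF that] by auto
  show ?thesis
    unfolding bilinear_map_def
  proof (intro conjI ballI)
    fix a b assume a: "a \<in> carrier A" and b: "b \<in> carrier B"
    note tab = t_closed[OF a b]
    show "h (t a b) \<in> carrier V" by (rule lin(1)[OF tab])
    show "h (t (a \<oplus>\<^bsub>A\<^esub> a') b) = h (t a b) \<oplus>\<^bsub>V\<^esub> h (t a' b)" if a': "a' \<in> carrier A" for a'
      using rel[OF half_relations.add_left[OF t a a' b]] lin(2)[OF tab t_closed[OF a' b]] by simp
    show "h (t a (b \<oplus>\<^bsub>B\<^esub> b')) = h (t a b) \<oplus>\<^bsub>V\<^esub> h (t a b')" if b': "b' \<in> carrier B" for b'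
      using rel[OF half_relations.add_right[OF t a b b']] lin(2)[OF tab t_closed[OF a b']] by simp
    fix k assume k: "k \<in> carrier K"
    show "h (t (k \<odot>\<^bsub>A\<^esub> a) b) = k \<odot>\<^bsub>V\<^esub> h (t a b)"
      using rel[OF half_relations.smult_left[OF t k a b]] lin(3)[OF tab k] by simp
    show "h (t a (k \<odot>\<^bsub>B\<^esub> b)) = k \<odot>\<^bsub>V\<^esub> h (t a b)"
      using rel[OF half_relations.smult_right[OF t k a b]] lin(3)[OF tab k] by simp
  qed
qed

end


section \<open>The space \<open>M \<boxtimes> N\<close> by generators and relations\<close>

locale compatible_awbs =
  fixes K :: "('k, 'r) ring_scheme"
    and M :: "('k, 'm, 'x) awb_scheme"
    and N :: "('k, 'n, 'y) awb_scheme"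
    and aMN :: "('m, 'n) action"
    and aNM :: "('n, 'm) action"
  assumes act_MN: "awb_action K M N aMN"
    and act_NM: "awb_action K N M aNM"
    and compat: "compatible M N aMN aNM"
begin

abbreviation "F \<equiv> free_vs K (gens M N)"
abbreviation "W \<equiv> box_subspace K M N aMN aNM"
abbreviation "V \<equiv> box_vs K M N aMN aNM"
abbreviation "\<gamma> \<equiv> box_gen K M N aMN aNM"
abbreviation "cls x \<equiv> W +>\<^bsub>F\<^esub> x"

lemma awb_M: "awb K M" and awb_N: "awb K N"
  using awb_action.axioms[OF act_MN] by auto

lemma module_M: "module K M" and module_N: "module K N"
  using awb_M awb_N awb.axioms by auto

lemma cring_K: "cring K"
  using module_M by (rule module.axioms)

lemma module_F: "module K F"
  by (rule free_vs_module[OF cring_K])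

lemma gens_iff:
  "DotMN m n \<in> gens M N \<longleftrightarrow> m \<in> carrier M \<and> n \<in> carrier N"
  "DotNM n m \<in> gens M N \<longleftrightarrow> m \<in> carrier M \<and> n \<in> carrier N"
  "StarMN m n \<in> gens M N \<longleftrightarrow> m \<in> carrier M \<and> n \<in> carrier N"
  "StarNM n m \<in> gens M N \<longleftrightarrow> m \<in> carrier M \<and> n \<in> carrier N"
  by (auto simp: gens_def)

lemma basic_pair_of_gen:
  "g \<in> gens M N \<Longrightarrow> (gen_M aNM g, gen_N aMN g) \<in> basic_pairs M N aMN aNM"
  by (auto simp: basic_pairs_def)

lemma gen_closed:
  assumes "g \<in> gens M N"
  shows "gen_M aNM g \<in> carrier M" "gen_N aMN g \<in> carrier N"
  using basic_pairs_closed[OF act_MN act_NM basic_pair_of_gen[OF assms]] .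

sublocale MN: symbol_families K M N aMN F
  "\<lambda>m n. sym_vec K (DotMN m n)" "\<lambda>n m. sym_vec K (DotNM n m)"
  "\<lambda>m n. sym_vec K (StarMN m n)" "\<lambda>n m. sym_vec K (StarNM n m)"
  by (rule symbol_families.intro[OF act_MN module_F]) (simp add: sym_vec_closed[OF cring_K] gens_iff)

sublocale NM: symbol_families K N M aNM F
  "\<lambda>n m. sym_vec K (DotNM n m)" "\<lambda>m n. sym_vec K (DotMN m n)"
  "\<lambda>n m. sym_vec K (StarNM n m)" "\<lambda>m n. sym_vec K (StarMN m n)"
  by (rule symbol_families.intro[OF act_NM module_F]) (simp add: sym_vec_closed[OF cring_K] gens_iff)

lemma box_relations_cases:
  assumes "(x, y) \<in> box_relations K M N aMN aNM"
  obtains (MN) "(x, y) \<in> half_relations K M N aMN F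
      (\<lambda>m n. sym_vec K (DotMN m n)) (\<lambda>n m. sym_vec K (DotNM n m))
      (\<lambda>m n. sym_vec K (StarMN m n)) (\<lambda>n m. sym_vec K (StarNM n m))"
    | (NM) "(x, y) \<in> half_relations K N M aNM F
      (\<lambda>n m. sym_vec K (DotNM n m)) (\<lambda>m n. sym_vec K (DotMN m n))
      (\<lambda>n m. sym_vec K (StarNM n m)) (\<lambda>m n. sym_vec K (StarMN m n))"
    | (dot) u\<^sub>M u\<^sub>N v\<^sub>M v\<^sub>N where "(u\<^sub>M, u\<^sub>N) \<in> basic_pairs M N aMN aNM"
      "(v\<^sub>M, v\<^sub>N) \<in> basic_pairs M N aMN aNM"
      "x = sym_vec K (DotMN u\<^sub>M v\<^sub>N)" "y = sym_vec K (DotNM u\<^sub>N v\<^sub>M)"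
    | (star) u\<^sub>M u\<^sub>N v\<^sub>M v\<^sub>N where "(u\<^sub>M, u\<^sub>N) \<in> basic_pairs M N aMN aNM"
      "(v\<^sub>M, v\<^sub>N) \<in> basic_pairs M N aMN aNM"
      "x = sym_vec K (StarMN u\<^sub>M v\<^sub>N)" "y = sym_vec K (StarNM u\<^sub>N v\<^sub>M)"
  using assms unfolding box_relations_def Let_def by blast

lemma box_relations_closed:
  assumes "(x, y) \<in> box_relations K M N aMN aNM"
  shows "x \<in> carrier F \<and> y \<in> carrier F"
  using assms
proof (cases rule: box_relations_cases)
  case MN
  then show ?thesis by (rule MN.half_relations_closed)
next
  case NM
  then show ?thesis by (rule NM.half_relations_closed)
next
  case dot
  then show ?thesis using basic_pairs_closed[OF act_MN act_NM]
    by (simp add: sym_vec_closed[OF cring_K] gens_iff)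
next
  case star
  then show ?thesis using basic_pairs_closed[OF act_MN act_NM]
    by (simp add: sym_vec_closed[OF cring_K] gens_iff)
qed

lemma submodule_W: "submodule W K F"
proof -
  interpret F: module K F by (rule module_F)
  show ?thesis
    unfolding box_subspace_def Let_def
    by (rule hull_submodule[OF module_F]) (auto dest!: box_relations_closed)
qed

lemma module_V: "module K V"
  unfolding box_vs_def by (rule quotient_vs_module[OF module_F submodule_W])

lemma cls_linear: "linear_map K F V (\<lambda>x. cls x)"
  unfolding box_vs_def by (rule coset_linear[OF module_F submodule_W])

lemma V_carrier: "carrier V = (\<lambda>x. cls x) ` carrier F"
  by (simp add: box_vs_def quotient_vs_carrier)

lemma box_relation_holds:
  assumes "(x, y) \<in> box_relations K M N aMN aNM"
  shows "cls x = cls y"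
proof -
  have "x \<ominus>\<^bsub>F\<^esub> y \<in> W"
    unfolding box_subspace_def Let_def using assms by (intro hull_inc) auto
  then show ?thesis
    using coset_eq_iff[OF module_F submodule_W] box_relations_closed[OF assms] by blast
qed

lemma box_gen_closed: "g \<in> gens M N \<Longrightarrow> \<gamma> g \<in> carrier V"
  unfolding box_gen_def by (rule linear_mapD(1)[OF cls_linear sym_vec_closed[OF cring_K]])

text \<open>
  The universal property of \<open>M \<boxtimes> N\<close>: the kernel of the linear extension of \<open>f\<close> is a submodule containing
  all differences of related vectors, hence the submodule that they generate.
\<close>

lemma box_lift:
  assumes B: "module K B" and f: "f \<in> gens M N \<rightarrow> carrier B"
    and rel: "\<And>x y. (x, y) \<in> box_relations K M N aMN aNM \<Longrightarrow> lin_ext K B f x = lin_ext K B f y"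
  shows "\<exists>h. linear_map K V B h \<and> (\<forall>g\<in>gens M N. h (\<gamma> g) = f g)"
proof -
  interpret B: module K B by fact
  note lin = lin_ext_linear[OF B f]
  have "W \<subseteq> {x \<in> carrier F. lin_ext K B f x = \<zero>\<^bsub>B\<^esub>}"
    unfolding box_subspace_def Let_def
  proof (rule hull_minimal)
    show "submodule {x \<in> carrier F. lin_ext K B f x = \<zero>\<^bsub>B\<^esub>} K F"
      by (rule kernel_submodule[OF module_F B lin])
    interpret F: module K F by (rule module_F)
    have "x \<ominus>\<^bsub>F\<^esub> y \<in> carrier F \<and> lin_ext K B f (x \<ominus>\<^bsub>F\<^esub> y) = \<zero>\<^bsub>B\<^esub>"
      if xy: "(x, y) \<in> box_relations K M N aMN aNM" for x y
    proof -
      have c: "x \<in> carrier F" "y \<in> carrier F" using box_relations_closed[OF xy] by auto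
      then show ?thesis
        using linear_map_diff[OF module_F B lin c] linear_mapD(1)[OF lin] rel[OF xy]
        by (simp add: B.minus_eq B.r_neg)
    qed
    then show "(\<lambda>(x, y). x \<ominus>\<^bsub>F\<^esub> y) ` box_relations K M N aMN aNM
        \<subseteq> {x \<in> carrier F. lin_ext K B f x = \<zero>\<^bsub>B\<^esub>}" by auto
  qed
  then have van: "lin_ext K B f x = \<zero>\<^bsub>B\<^esub>" if "x \<in> W" for x using that by blast
  obtain h where h: "linear_map K V B h" "\<And>x. x \<in> carrier F \<Longrightarrow> h (cls x) = lin_ext K B f x"
    using quotient_vs_lift[OF module_F submodule_W B lin van] unfolding box_vs_def by metis
  have "h (\<gamma> g) = f g" if "g \<in> gens M N" for g
    using h(2)[OF sym_vec_closed[OF cring_K that]] lin_ext_sym_vec[OF B f that]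
    by (simp add: box_gen_def)
  then show ?thesis using h(1) by blast
qed

lemma box_linear_eqI:
  assumes B: "module K B" and f: "linear_map K V B f" and g: "linear_map K V B g"
    and eq: "\<And>x. x \<in> gens M N \<Longrightarrow> f (\<gamma> x) = g (\<gamma> x)" and v: "v \<in> carrier V"
  shows "f v = g v"
proof -
  let ?E = "{x \<in> carrier F. f (cls x) = g (cls x)}"
  obtain x where x: "x \<in> carrier F" "v = cls x" using v by (auto simp: V_carrier)
  have "submodule ?E K F"
    by (rule equalizer_submodule[OF module_F B linear_map_compose[OF cls_linear f]
          linear_map_compose[OF cls_linear g]])
  moreover have "sym_vec K ` gens M N \<subseteq> ?E"
    using eq sym_vec_closed[OF cring_K] by (auto simp: box_gen_def)
  ultimately have "x \<in> ?E" using free_vs_generated[OF cring_K _ _ x(1)] by blast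
  then show ?thesis by (simp add: x(2))
qed

lemma box_bilinear_eqI:
  assumes B: "module K B" and f: "bilinear_map K V V B f" and g: "bilinear_map K V V B g"
    and eq: "\<And>x y. \<lbrakk>x \<in> gens M N; y \<in> gens M N\<rbrakk> \<Longrightarrow> f (\<gamma> x) (\<gamma> y) = g (\<gamma> x) (\<gamma> y)"
    and v: "v \<in> carrier V" and w: "w \<in> carrier V"
  shows "f v w = g v w"
proof (rule box_linear_eqI[OF B bilinear_map_left[OF f w] bilinear_map_left[OF g w] _ v])
  fix x assume x: "x \<in> gens M N"
  note gx = box_gen_closed[OF x]
  show "f (\<gamma> x) w = g (\<gamma> x) w"
    by (rule box_linear_eqI[OF B bilinear_map_right[OF f gx] bilinear_map_right[OF g gx] eq[OF x] w])
qed


section \<open>The projections to \<open>M\<close> and \<open>N\<close>\<close>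

text \<open>
  Both sides of a relation between basic pairs are sent to the product, or to the bracket, of
  \<open>u\<^sub>M\<close> and \<open>v\<^sub>M\<close>. The two halves of the remaining relations are covered by \<open>half_relations_first\<close>
  and \<open>half_relations_second\<close>: \<open>M\<close> is the acting algebra in one half and is acted upon in the other.
\<close>

lemma box_projection_M:
  "\<exists>\<phi>. linear_map K V M \<phi> \<and> (\<forall>g\<in>gens M N. \<phi> (\<gamma> g) = gen_M aNM g)"
proof (rule box_lift[OF module_M])
  show f: "gen_M aNM \<in> gens M N \<rightarrow> carrier M" using gen_closed by blast
  note h = lin_ext_linear[OF module_M f]
  have val: "lin_ext K M (gen_M aNM) (sym_vec K g) = gen_M aNM g" if "g \<in> gens M N" for g
    by (rule lin_ext_sym_vec[OF module_M f that])
  fix x y assume "(x, y) \<in> box_relations K M N aMN aNM"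
  then show "lin_ext K M (gen_M aNM) x = lin_ext K M (gen_M aNM) y"
  proof (cases rule: box_relations_cases)
    case MN
    show ?thesis
      by (rule MN.half_relations_first[OF act_NM compat h _ _ _ _ MN]) (simp_all add: val gens_iff)
  next
    case NM
    show ?thesis
      by (rule NM.half_relations_second[OF h _ _ _ _ NM]) (simp_all add: val gens_iff)
  next
    case (dot u\<^sub>M u\<^sub>N v\<^sub>M v\<^sub>N)
    note c = basic_pairs_closed[OF act_MN act_NM dot(1)] basic_pairs_closed[OF act_MN act_NM dot(2)]
    show ?thesis using c compatibleD[OF compat dot(1) c(3)] compatibleD[OF compat dot(2) c(1)]
      by (simp add: dot(3,4) val gens_iff)
  next
    case (star u\<^sub>M u\<^sub>N v\<^sub>M v\<^sub>N)
    note c = basic_pairs_closed[OF act_MN act_NM star(1)] basic_pairs_closed[OF act_MN act_NM star(2)]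
    show ?thesis using c compatibleD[OF compat star(1) c(3)] compatibleD[OF compat star(2) c(1)]
      by (simp add: star(3,4) val gens_iff)
  qed
qed

lemma box_projection_N:
  "\<exists>\<psi>. linear_map K V N \<psi> \<and> (\<forall>g\<in>gens M N. \<psi> (\<gamma> g) = gen_N aMN g)"
proof (rule box_lift[OF module_N])
  show f: "gen_N aMN \<in> gens M N \<rightarrow> carrier N" using gen_closed by blast
  note h = lin_ext_linear[OF module_N f]
  have val: "lin_ext K N (gen_N aMN) (sym_vec K g) = gen_N aMN g" if "g \<in> gens M N" for g
    by (rule lin_ext_sym_vec[OF module_N f that])
  note compat' = compatible_swap[OF compat]
  fix x y assume "(x, y) \<in> box_relations K M N aMN aNM"
  then show "lin_ext K N (gen_N aMN) x = lin_ext K N (gen_N aMN) y"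
  proof (cases rule: box_relations_cases)
    case MN
    show ?thesis
      by (rule MN.half_relations_second[OF h _ _ _ _ MN]) (simp_all add: val gens_iff)
  next
    case NM
    show ?thesis
      by (rule NM.half_relations_first[OF act_MN compat' h _ _ _ _ NM]) (simp_all add: val gens_iff)
  next
    case (dot u\<^sub>M u\<^sub>N v\<^sub>M v\<^sub>N)
    note c = basic_pairs_closed[OF act_MN act_NM dot(1)] basic_pairs_closed[OF act_MN act_NM dot(2)]
    note sw = basic_pairs_swap[THEN iffD2, OF dot(1)] basic_pairs_swap[THEN iffD2, OF dot(2)]
    show ?thesis using c compatibleD[OF compat' sw(1) c(4)] compatibleD[OF compat' sw(2) c(2)]
      by (simp add: dot(3,4) val gens_iff)
  next
    case (star u\<^sub>M u\<^sub>N v\<^sub>M v\<^sub>N)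
    note c = basic_pairs_closed[OF act_MN act_NM star(1)] basic_pairs_closed[OF act_MN act_NM star(2)]
    note sw = basic_pairs_swap[THEN iffD2, OF star(1)] basic_pairs_swap[THEN iffD2, OF star(2)]
    show ?thesis using c compatibleD[OF compat' sw(1) c(4)] compatibleD[OF compat' sw(2) c(2)]
      by (simp add: star(3,4) val gens_iff)
  qed
qed


section \<open>The operations\<close>

definition \<phi>\<^sub>M where
  "\<phi>\<^sub>M = (SOME \<phi>. linear_map K V M \<phi> \<and> (\<forall>g\<in>gens M N. \<phi> (\<gamma> g) = gen_M aNM g))"

definition \<phi>\<^sub>N where
  "\<phi>\<^sub>N = (SOME \<phi>. linear_map K V N \<phi> \<and> (\<forall>g\<in>gens M N. \<phi> (\<gamma> g) = gen_N aMN g))"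

lemma \<phi>\<^sub>M: "linear_map K V M \<phi>\<^sub>M" "g \<in> gens M N \<Longrightarrow> \<phi>\<^sub>M (\<gamma> g) = gen_M aNM g"
  using someI_ex[OF box_projection_M] unfolding \<phi>\<^sub>M_def by auto

lemma \<phi>\<^sub>N: "linear_map K V N \<phi>\<^sub>N" "g \<in> gens M N \<Longrightarrow> \<phi>\<^sub>N (\<gamma> g) = gen_N aMN g"
  using someI_ex[OF box_projection_N] unfolding \<phi>\<^sub>N_def by auto

lemmas \<phi>_closed = linear_mapD(1)[OF \<phi>\<^sub>M(1)] linear_mapD(1)[OF \<phi>\<^sub>N(1)]

lemma box_relationsI:
  "r \<in> half_relations K M N aMN F
      (\<lambda>m n. sym_vec K (DotMN m n)) (\<lambda>n m. sym_vec K (DotNM n m))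
      (\<lambda>m n. sym_vec K (StarMN m n)) (\<lambda>n m. sym_vec K (StarNM n m))
    \<Longrightarrow> r \<in> box_relations K M N aMN aNM"
  "r \<in> half_relations K N M aNM F
      (\<lambda>n m. sym_vec K (DotNM n m)) (\<lambda>m n. sym_vec K (DotMN m n))
      (\<lambda>n m. sym_vec K (StarNM n m)) (\<lambda>m n. sym_vec K (StarMN m n))
    \<Longrightarrow> r \<in> box_relations K M N aMN aNM"
  by (simp_all add: box_relations_def Let_def)

text \<open>
  The symbols \<open>m \<odot> n\<close> and \<open>m \<circledast> n\<close> give the operations; the symbols \<open>n \<odot> m\<close> come in through the
  relation for \<open>(m\<^sub>1 m\<^sub>2) \<circledast> n\<close>.
\<close>

lemma symbols_bilinear:
  "bilinear_map K M N V (\<lambda>m n. \<gamma> (DotMN m n))"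
  "bilinear_map K M N V (\<lambda>m n. \<gamma> (StarMN m n))"
  "bilinear_map K N M V (\<lambda>n m. \<gamma> (DotNM n m))"
proof -
  note rel = box_relation_holds[OF box_relationsI(1)] box_relation_holds[OF box_relationsI(2)]
  show "bilinear_map K M N V (\<lambda>m n. \<gamma> (DotMN m n))"
    unfolding box_gen_def by (rule MN.half_relations_bilinear[OF cls_linear insertI1 rel(1)])
  show "bilinear_map K M N V (\<lambda>m n. \<gamma> (StarMN m n))"
    unfolding box_gen_def
    by (rule MN.half_relations_bilinear[OF cls_linear insertI2[OF singletonI] rel(1)])
  show "bilinear_map K N M V (\<lambda>n m. \<gamma> (DotNM n m))"
    unfolding box_gen_def by (rule NM.half_relations_bilinear[OF cls_linear insertI1 rel(2)])
qed

lemma mult_dot: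
  assumes "m \<in> carrier M" "m' \<in> carrier M" "n \<in> carrier N"
  shows "\<gamma> (DotMN (m \<otimes>\<^bsub>M\<^esub> m') n) = \<gamma> (DotMN m (ldot aMN m' n))"
  unfolding box_gen_def
  by (rule box_relation_holds[OF box_relationsI(1)[OF half_relations.mult_dot[OF assms]]])

lemma mult_star:
  assumes "m \<in> carrier M" "m' \<in> carrier M" "n \<in> carrier N"
  shows "\<gamma> (StarMN (m \<otimes>\<^bsub>M\<^esub> m') n)
    = \<gamma> (DotMN m (lstar aMN m' n)) \<oplus>\<^bsub>V\<^esub> \<gamma> (DotNM (lstar aMN m n) m')"
proof -
  have "sym_vec K (DotMN m (lstar aMN m' n)) \<in> carrier F" "sym_vec K (DotNM (lstar aMN m n) m') \<in> carrier F"
    using assms by (simp_all add: MN.symbol_closed MN.operation_closed)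
  then show ?thesis
    using box_relation_holds[OF box_relationsI(1)[OF half_relations.mult_star[OF assms]]]
      linear_mapD(2)[OF cls_linear] by (simp add: box_gen_def)
qed

text \<open>
  On generators this is the defining relation between two basic pairs; both sides are bilinear.
\<close>

lemma dot_swap:
  assumes "x \<in> carrier V" "y \<in> carrier V"
  shows "\<gamma> (DotNM (\<phi>\<^sub>N x) (\<phi>\<^sub>M y)) = \<gamma> (DotMN (\<phi>\<^sub>M x) (\<phi>\<^sub>N y))"
proof (rule box_bilinear_eqI[OF module_V _ _ _ assms])
  show "bilinear_map K V V V (\<lambda>x y. \<gamma> (DotNM (\<phi>\<^sub>N x) (\<phi>\<^sub>M y)))"
    by (rule bilinear_map_compose[OF symbols_bilinear(3) \<phi>\<^sub>N(1) \<phi>\<^sub>M(1)])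
  show "bilinear_map K V V V (\<lambda>x y. \<gamma> (DotMN (\<phi>\<^sub>M x) (\<phi>\<^sub>N y)))"
    by (rule bilinear_map_compose[OF symbols_bilinear(1) \<phi>\<^sub>M(1) \<phi>\<^sub>N(1)])
  fix g h assume g: "g \<in> gens M N" and h: "h \<in> gens M N"
  have "(sym_vec K (DotMN (gen_M aNM g) (gen_N aMN h)), sym_vec K (DotNM (gen_N aMN g) (gen_M aNM h)))
      \<in> box_relations K M N aMN aNM"
    using basic_pair_of_gen[OF g] basic_pair_of_gen[OF h]
    unfolding box_relations_def Let_def by blast
  from box_relation_holds[OF this]
  show "\<gamma> (DotNM (\<phi>\<^sub>N (\<gamma> g)) (\<phi>\<^sub>M (\<gamma> h))) = \<gamma> (DotMN (\<phi>\<^sub>M (\<gamma> g)) (\<phi>\<^sub>N (\<gamma> h)))"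
    using g h by (simp add: \<phi>\<^sub>M \<phi>\<^sub>N box_gen_def[symmetric])
qed

text \<open>
  Compatibility extended by linearity from basic pairs to all pairs \<open>(\<phi>\<^sub>M(y), \<phi>\<^sub>N(y))\<close>.
\<close>

lemma rdot_\<phi>\<^sub>N:
  assumes "m \<in> carrier M" "y \<in> carrier V"
  shows "rdot aNM m (\<phi>\<^sub>N y) = m \<otimes>\<^bsub>M\<^esub> \<phi>\<^sub>M y"
proof (rule box_linear_eqI[OF module_M _ _ _ assms(2)])
  show "linear_map K V M (\<lambda>y. rdot aNM m (\<phi>\<^sub>N y))"
    by (rule linear_map_compose[OF \<phi>\<^sub>N(1) bilinear_map_right[OF awb_action.rdot_bilinear[OF act_NM] assms(1)]])
  show "linear_map K V M (\<lambda>y. m \<otimes>\<^bsub>M\<^esub> \<phi>\<^sub>M y)"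
    by (rule linear_map_compose[OF \<phi>\<^sub>M(1) bilinear_map_right[OF awb.mult_bilinear[OF awb_M] assms(1)]])
  fix g assume g: "g \<in> gens M N"
  show "rdot aNM m (\<phi>\<^sub>N (\<gamma> g)) = m \<otimes>\<^bsub>M\<^esub> \<phi>\<^sub>M (\<gamma> g)"
    using compatibleD(1)[OF compat basic_pair_of_gen[OF g] assms(1)] by (simp add: \<phi>\<^sub>M \<phi>\<^sub>N g)
qed

lemma box_operations_exist:
  "box_operations K M N aMN aNM
     (\<lambda>x y. \<gamma> (DotMN (\<phi>\<^sub>M x) (\<phi>\<^sub>N y))) (\<lambda>x y. \<gamma> (StarMN (\<phi>\<^sub>M x) (\<phi>\<^sub>N y)))"
  unfolding box_operations_def Let_def
  using bilinear_map_compose[OF symbols_bilinear(1) \<phi>\<^sub>M(1) \<phi>\<^sub>N(1)]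
    bilinear_map_compose[OF symbols_bilinear(2) \<phi>\<^sub>M(1) \<phi>\<^sub>N(1)]
  by (simp add: \<phi>\<^sub>M \<phi>\<^sub>N)

lemma box_operations_unique:
  assumes "box_operations K M N aMN aNM p b" "x \<in> carrier V" "y \<in> carrier V"
  shows "p x y = \<gamma> (DotMN (\<phi>\<^sub>M x) (\<phi>\<^sub>N y))" "b x y = \<gamma> (StarMN (\<phi>\<^sub>M x) (\<phi>\<^sub>N y))"
proof -
  note pb = assms(1) box_operations_exist
  show "p x y = \<gamma> (DotMN (\<phi>\<^sub>M x) (\<phi>\<^sub>N y))"
    by (rule box_bilinear_eqI[OF module_V _ _ _ assms(2,3)])
      (use pb in \<open>simp_all add: box_operations_def Let_def\<close>)
  show "b x y = \<gamma> (StarMN (\<phi>\<^sub>M x) (\<phi>\<^sub>N y))"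
    by (rule box_bilinear_eqI[OF module_V _ _ _ assms(2,3)])
      (use pb in \<open>simp_all add: box_operations_def Let_def\<close>)
qed

text \<open>
  Product and bracket of arbitrary \<open>x\<close> and \<open>y\<close> are classes of single symbols, so their components are
  read off from the values on generators. In the first equation compatibility then turns the action of
  \<open>\<phi>\<^sub>N(y)\<close> into multiplication by \<open>\<phi>\<^sub>M(y)\<close>.
\<close>

lemma \<phi>_operations:
  assumes "x \<in> carrier V" "y \<in> carrier V"
  shows "\<phi>\<^sub>M (\<gamma> (DotMN (\<phi>\<^sub>M x) (\<phi>\<^sub>N y))) = \<phi>\<^sub>M x \<otimes>\<^bsub>M\<^esub> \<phi>\<^sub>M y"
    and "\<phi>\<^sub>N (\<gamma> (DotMN (\<phi>\<^sub>M x) (\<phi>\<^sub>N y))) = ldot aMN (\<phi>\<^sub>M x) (\<phi>\<^sub>N y)"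
    and "\<phi>\<^sub>N (\<gamma> (StarMN (\<phi>\<^sub>M x) (\<phi>\<^sub>N y))) = lstar aMN (\<phi>\<^sub>M x) (\<phi>\<^sub>N y)"
  using assms by (simp_all add: \<phi>\<^sub>M \<phi>\<^sub>N gens_iff \<phi>_closed rdot_\<phi>\<^sub>N)

lemma box_mult_assoc:
  assumes "x \<in> carrier V" "y \<in> carrier V" "z \<in> carrier V"
  defines "p \<equiv> \<lambda>x y. \<gamma> (DotMN (\<phi>\<^sub>M x) (\<phi>\<^sub>N y))"
  shows "p (p x y) z = p x (p y z)"
  using assms(1-3) by (simp add: p_def \<phi>_operations mult_dot \<phi>_closed)

text \<open>
  The relation for \<open>(m\<^sub>1 m\<^sub>2) \<circledast> n\<close> produces a summand \<open>n \<odot> m\<close>, which \<open>dot_swap\<close> brings into the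
  form of a product.
\<close>

lemma box_bracket_mult:
  assumes x: "x \<in> carrier V" and y: "y \<in> carrier V" and z: "z \<in> carrier V"
  defines "p \<equiv> \<lambda>x y. \<gamma> (DotMN (\<phi>\<^sub>M x) (\<phi>\<^sub>N y))" and "b \<equiv> \<lambda>x y. \<gamma> (StarMN (\<phi>\<^sub>M x) (\<phi>\<^sub>N y))"
  shows "b (p x y) z = p (b x z) y \<oplus>\<^bsub>V\<^esub> p x (b y z)"
proof -
  interpret V: module K V by (rule module_V)
  have bV: "b v w \<in> carrier V" if "v \<in> carrier V" "w \<in> carrier V" for v w
    using that by (simp add: b_def box_gen_closed gens_iff \<phi>_closed)
  have pV: "p v w \<in> carrier V" if "v \<in> carrier V" "w \<in> carrier V" for v w
    using that by (simp add: p_def box_gen_closed gens_iff \<phi>_closed)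
  have "b (p x y) z = \<gamma> (StarMN (\<phi>\<^sub>M x \<otimes>\<^bsub>M\<^esub> \<phi>\<^sub>M y) (\<phi>\<^sub>N z))"
    unfolding b_def p_def by (simp only: \<phi>_operations(1)[OF x y])
  also have "\<dots> = \<gamma> (DotMN (\<phi>\<^sub>M x) (lstar aMN (\<phi>\<^sub>M y) (\<phi>\<^sub>N z)))
      \<oplus>\<^bsub>V\<^esub> \<gamma> (DotNM (lstar aMN (\<phi>\<^sub>M x) (\<phi>\<^sub>N z)) (\<phi>\<^sub>M y))"
    using x y z by (intro mult_star \<phi>_closed)
  also have "\<gamma> (DotMN (\<phi>\<^sub>M x) (lstar aMN (\<phi>\<^sub>M y) (\<phi>\<^sub>N z))) = p x (b y z)"
    unfolding p_def b_def by (simp only: \<phi>_operations(3)[OF y z])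
  also have "\<gamma> (DotNM (lstar aMN (\<phi>\<^sub>M x) (\<phi>\<^sub>N z)) (\<phi>\<^sub>M y)) = \<gamma> (DotNM (\<phi>\<^sub>N (b x z)) (\<phi>\<^sub>M y))"
    unfolding b_def by (simp only: \<phi>_operations(3)[OF x z])
  also have "\<dots> = p (b x z) y"
    unfolding p_def by (rule dot_swap[OF bV[OF x z] y])
  finally show ?thesis
    using V.a_comm[OF pV[OF x bV[OF y z]] pV[OF bV[OF x z] y]] by simp
qed

end

lemma module_with_operations:
  assumes "module K V"
  shows "module K (with_operations V p b)"
proof -
  interpret V: module K V by fact
  have eqs: "carrier (with_operations V p b) = carrier V" "\<zero>\<^bsub>with_operations V p b\<^esub> = \<zero>\<^bsub>V\<^esub>"
    "x \<oplus>\<^bsub>with_operations V p b\<^esub> y = x \<oplus>\<^bsub>V\<^esub> y" "k \<odot>\<^bsub>with_operations V p b\<^esub> x = k \<odot>\<^bsub>V\<^esub> x" for x y k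
    by (simp_all add: with_operations_def)
  have "abelian_group (with_operations V p b)"
  proof (rule abelian_groupI, unfold eqs)
    show "\<exists>y\<in>carrier V. y \<oplus>\<^bsub>V\<^esub> x = \<zero>\<^bsub>V\<^esub>" if "x \<in> carrier V" for x
      using V.l_neg[OF that] V.a_inv_closed[OF that] by blast
  qed (simp_all add: V.a_ac)
  then show ?thesis
    by (intro moduleI, unfold eqs)
      (simp_all add: V.R.cring_axioms V.smult_l_distr V.smult_r_distr V.smult_assoc1)
qed

theorem proposition4p3:
  fixes K :: "('k, 'r) ring_scheme"
    and M :: "('k, 'm, 'x) awb_scheme"
    and N :: "('k, 'n, 'y) awb_scheme"
    and aMN :: "('m, 'n) action"
    and aNM :: "('n, 'm) action"
  assumes "field K"
    and "awb K M"
    and "awb K N"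
    and "awb_action K M N aMN"
    and "awb_action K N M aNM"
    and "compatible M N aMN aNM"
  shows "(\<exists>p b. box_operations K M N aMN aNM p b) \<and>
         (\<forall>p b. box_operations K M N aMN aNM p b \<longrightarrow>
            awb K (with_operations (box_vs K M N aMN aNM) p b))"
proof (intro conjI allI impI)
  interpret compatible_awbs K M N aMN aNM
    using assms(4-6) by (rule compatible_awbs.intro)
  show "\<exists>p b. box_operations K M N aMN aNM p b"
    using box_operations_exist by blast
  fix p b assume pb: "box_operations K M N aMN aNM p b"
  let ?A = "with_operations V p b"
  have A: "carrier ?A = carrier V" "x \<otimes>\<^bsub>?A\<^esub> y = p x y" "x \<oplus>\<^bsub>?A\<^esub> y = x \<oplus>\<^bsub>V\<^esub> y"
    "bracket ?A x y = b x y" for x y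
    by (simp_all add: with_operations_def)
  have bil: "bilinear_map K V V V p" "bilinear_map K V V V b"
    using pb by (simp_all add: box_operations_def Let_def)
  note closed = bil[THEN bilinear_map_closed]
  note eqs = box_operations_unique[OF pb]
  show "awb K ?A"
  proof (rule awb.intro[OF assms(1) module_with_operations[OF module_V]], rule awb_axioms.intro)
    show "bilinear_map K ?A ?A ?A (mult ?A)" "bilinear_map K ?A ?A ?A (bracket ?A)"
      using bil by (simp_all add: bilinear_map_def with_operations_def)
    fix x y z assume "x \<in> carrier ?A" "y \<in> carrier ?A" "z \<in> carrier ?A"
    then have c: "x \<in> carrier V" "y \<in> carrier V" "z \<in> carrier V" by (simp_all add: A)
    show "(x \<otimes>\<^bsub>?A\<^esub> y) \<otimes>\<^bsub>?A\<^esub> z = x \<otimes>\<^bsub>?A\<^esub> (y \<otimes>\<^bsub>?A\<^esub> z)"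
      using box_mult_assoc[OF c] c closed by (simp add: A eqs[symmetric])
    show "bracket ?A (x \<otimes>\<^bsub>?A\<^esub> y) z = bracket ?A x z \<otimes>\<^bsub>?A\<^esub> y \<oplus>\<^bsub>?A\<^esub> x \<otimes>\<^bsub>?A\<^esub> bracket ?A y z"
      using box_bracket_mult[OF c] c closed by (simp add: A eqs[symmetric])
  qed
qed

end
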